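(* Suppose $p\neq2$ and let $\alpha,\beta_1,\beta_2\in\widehat{\mathbb{F}_q^\times}$ with $\varepsilon\notin\{\beta_1,\beta_2\}$. Then for $\lambda\in\mathbb{F}_q$, $\lambda\neq1$, $$F_2\!\left({\alpha^2;\beta_1,\beta_2\atop\beta_1^2,\beta_2^2};1+\lambda,1-\lambda\right)=\overline{\alpha}^2\Big(\frac{1-\lambda}{2}\Big)\sum_{\alpha'\in\{\alpha,\alpha\phi\}}\frac{(\overline{\beta_2}\phi)_{\alpha'}}{(\phi)_{\alpha'}}\,{}_2F_1\!\left({\alpha',\alpha'\overline{\beta_2}\phi\atop\beta_1\phi};\Big(\frac{1+\lambda}{1-\lambda}\Big)^2\right).$$
   Context: $\mathbb{F}_q$ is a finite field with $q$ elements and characteristic $p$. $\widehat{\mathbb{F}_q^\times}$ is the group of multiplicative characters $\mathbb{F}_q^\times\to\overline{\mathbb{Q}}^\times$, $\varepsilon$ the trivial character, $\phi$ the quadratic character; every character (including $\varepsilon$) is extended by $0$ at $0$; $\overline{\eta}=\eta^{-1}$; $\delta(\eta)=1$ if $\eta=\varepsilon$, else $0$. $\psi$ is a fixed non-trivial additive character. $g(\eta)=-\sum_{x\in\mathbb{F}_q^\times}\psi(x)\eta(x)$, $g^\circ(\eta)=q^{\delta(\eta)}g(\eta)$, $(\alpha)_\nu=g(\alpha\nu)/g(\alpha)$, $(\alpha)^\circ_\nu=g^\circ(\alpha\nu)/g^\circ(\alpha)$. For $\lambda\in\mathbb{F}_q$, ${}_2F_1\!\left({\alpha,\beta\atop\gamma};\lambda\right)=\frac{1}{1-q}\sum_{\nu}\frac{(\alpha)_\nu(\beta)_\nu}{(\varepsilon)^\circ_\nu(\gamma)^\circ_\nu}\nu(\lambda)$;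 for $x,y\in\mathbb{F}_q$, $F_2\!\left({\alpha;\beta_1,\beta_2\atop\gamma_1,\gamma_2};x,y\right)=\frac{1}{(1-q)^2}\sum_{\nu_1,\nu_2}\frac{(\alpha)_{\nu_1\nu_2}(\beta_1)_{\nu_1}(\beta_2)_{\nu_2}}{(\gamma_1)^\circ_{\nu_1}(\gamma_2)^\circ_{\nu_2}(\varepsilon)^\circ_{\nu_1}(\varepsilon)^\circ_{\nu_2}}\nu_1(x)\nu_2(y)$, sums over characters. *)

theory Defs
  imports Complex_Main
begin

text \<open>Multiplicative characters of the finite field 'a, valued in complex numbers
  (a model of the algebraic closure of Q), extended by 0 at 0 (also the trivial one).\<close>
definition mult_char :: "('a::{field,finite} \<Rightarrow> complex) \<Rightarrow> bool" where
  "mult_char \<chi> \<longleftrightarrow> \<chi> 0 = 0 \<and> \<chi> 1 = 1 \<and>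
     (\<forall>x y. x \<noteq> 0 \<longrightarrow> y \<noteq> 0 \<longrightarrow> \<chi> (x * y) = \<chi> x * \<chi> y)"

definition chars :: "('a::{field,finite} \<Rightarrow> complex) set" where
  "chars = {\<chi>. mult_char \<chi>}"

definition nontriv_add_char :: "('a::{field,finite} \<Rightarrow> complex) \<Rightarrow> bool" where
  "nontriv_add_char \<psi> \<longleftrightarrow> (\<forall>x y. \<psi> (x + y) = \<psi> x * \<psi> y) \<and> (\<exists>x. \<psi> x \<noteq> 1)"

definition triv_char :: "'a::{field,finite} \<Rightarrow> complex" ("\<epsilon>") where
  "\<epsilon> x = (if x = 0 then 0 else 1)"

definition quad_char :: "'a::{field,finite} \<Rightarrow> complex" ("\<phi>") where
  "\<phi> x = (if x = 0 then 0 else if (\<exists>y. y ^ 2 = x) then 1 else -1)"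

definition cmul :: "('a \<Rightarrow> complex) \<Rightarrow> ('a \<Rightarrow> complex) \<Rightarrow> ('a \<Rightarrow> complex)" (infixl "\<cdot>" 70) where
  "cmul \<alpha> \<beta> = (\<lambda>x. \<alpha> x * \<beta> x)"

text \<open>conjugate = inverse character (0 at 0, since inverse 0 = 0)\<close>
definition cinv :: "('a \<Rightarrow> complex) \<Rightarrow> ('a \<Rightarrow> complex)" where
  "cinv \<alpha> = (\<lambda>x. inverse (\<alpha> x))"

definition delta :: "('a::{field,finite} \<Rightarrow> complex) \<Rightarrow> nat" where
  "delta \<eta> = (if \<eta> = \<epsilon> then 1 else 0)"

definition gauss :: "('a::{field,finite} \<Rightarrow> complex) \<Rightarrow> ('a \<Rightarrow> complex) \<Rightarrow> complex" where
  "gauss \<psi> \<eta> = - (\<Sum>x\<in>UNIV - {0}. \<psi> x * \<eta> x)"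

definition gauss0 :: "('a::{field,finite} \<Rightarrow> complex) \<Rightarrow> ('a \<Rightarrow> complex) \<Rightarrow> complex" where
  "gauss0 \<psi> \<eta> = of_nat (card (UNIV :: 'a set)) ^ delta \<eta> * gauss \<psi> \<eta>"

definition poch :: "('a::{field,finite} \<Rightarrow> complex) \<Rightarrow> ('a \<Rightarrow> complex) \<Rightarrow> ('a \<Rightarrow> complex) \<Rightarrow> complex" where
  "poch \<psi> \<alpha> \<nu> = gauss \<psi> (\<alpha> \<cdot> \<nu>) / gauss \<psi> \<alpha>"

definition poch0 :: "('a::{field,finite} \<Rightarrow> complex) \<Rightarrow> ('a \<Rightarrow> complex) \<Rightarrow> ('a \<Rightarrow> complex) \<Rightarrow> complex" where
  "poch0 \<psi> \<alpha> \<nu> = gauss0 \<psi> (\<alpha> \<cdot> \<nu>) / gauss0 \<psi> \<alpha>"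

definition hyp2F1 :: "('a::{field,finite} \<Rightarrow> complex) \<Rightarrow> ('a \<Rightarrow> complex) \<Rightarrow> ('a \<Rightarrow> complex)
    \<Rightarrow> ('a \<Rightarrow> complex) \<Rightarrow> 'a \<Rightarrow> complex" where
  "hyp2F1 \<psi> \<alpha> \<beta> \<gamma> t = 1 / (1 - of_nat (card (UNIV :: 'a set))) *
     (\<Sum>\<nu>\<in>chars. poch \<psi> \<alpha> \<nu> * poch \<psi> \<beta> \<nu> / (poch0 \<psi> \<epsilon> \<nu> * poch0 \<psi> \<gamma> \<nu>) * \<nu> t)"

definition appellF2 :: "('a::{field,finite} \<Rightarrow> complex) \<Rightarrow> ('a \<Rightarrow> complex) \<Rightarrow> ('a \<Rightarrow> complex)
    \<Rightarrow> ('a \<Rightarrow> complex) \<Rightarrow> ('a \<Rightarrow> complex) \<Rightarrow> ('a \<Rightarrow> complex) \<Rightarrow> 'a \<Rightarrow> 'a \<Rightarrow> complex" where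
  "appellF2 \<psi> \<alpha> \<beta>1 \<beta>2 \<gamma>1 \<gamma>2 x y = 1 / (1 - of_nat (card (UNIV :: 'a set))) ^ 2 *
     (\<Sum>\<nu>1\<in>chars. \<Sum>\<nu>2\<in>chars.
        poch \<psi> \<alpha> (\<nu>1 \<cdot> \<nu>2) * poch \<psi> \<beta>1 \<nu>1 * poch \<psi> \<beta>2 \<nu>2 /
        (poch0 \<psi> \<gamma>1 \<nu>1 * poch0 \<psi> \<gamma>2 \<nu>2 * poch0 \<psi> \<epsilon> \<nu>1 * poch0 \<psi> \<epsilon> \<nu>2) * \<nu>1 x * \<nu>2 y)"

end

theory Submission
  imports Defs "HOL-Algebra.Multiplicative_Group"
begin

text \<open>
  Writing the Gauss sum that couples the two summation variables as a sum over \<open>t\<close> gives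
  \<open>F2(x, y) = - 1/g(\<alpha>^2) \<cdot> \<Sum>t. \<psi>(t) \<alpha>^2(t) 1F1(\<beta>1; \<beta>1^2; xt) 1F1(\<beta>2; \<beta>2^2; yt)\<close>.
  Kummer's second formula turns each \<open>1F1\<close> into an additive character times a \<open>0F1\<close> of a
  multiple of \<open>t^2\<close>, and the additive characters cancel because \<open>x + y = 2\<close>. Substituting
  \<open>s = t^2\<close> introduces the factor \<open>1 + \<phi>(s)\<close>, hence the sum over \<open>\<alpha>' \<in> {\<alpha>, \<alpha>\<phi>}\<close>, and
  orthogonality collapses the product of two \<open>0F1\<close> to a single \<open>2F1\<close>; the constants match by the
  Hasse-Davenport relation. Kummer's formula itself follows from the integral representations of both
  sides, which are the two sides of a Salie-type identity.
\<close>

section \<open>Multiplicative characters\<close>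

abbreviation order_UNIV :: "'a::finite itself \<Rightarrow> complex" where
  "order_UNIV _ \<equiv> of_nat (card (UNIV :: 'a set))"

lemma card_field_gt_1: "card (UNIV :: 'a::{field,finite} set) > 1"
proof -
  have "card {0, 1 :: 'a} \<le> card (UNIV :: 'a set)"
    by (intro card_mono) auto
  then show ?thesis by simp
qed

section \<open>Cyclicity of the multiplicative group and discrete logarithms\<close>

text \<open>Cyclicity is available for fields given as records with a carrier, so the type is
  wrapped as such a record \<open>R\<close> with carrier \<open>UNIV\<close> and the generator is
  translated back.\<close>

lemma finite_field_generator:
  "\<exists>z :: 'a::{field,finite}. z \<noteq> 0 \<and> (\<forall>x. x \<noteq> 0 \<longrightarrow> (\<exists>k::nat. x = z ^ k))"
proof -
  define R :: "'a ring" where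
    "R = \<lparr>carrier = UNIV, monoid.mult = (*), one = 1, ring.zero = 0, add = (+)\<rparr>"
  have inv: "\<exists>y. x + y = 0" for x :: 'a
    by (rule exI[of _ "- x"]) simp
  have inv': "\<exists>y. x * y = 1" if "x \<noteq> 0" for x :: 'a
    using that by (intro exI[of _ "inverse x"]) simp
  interpret R: field R
    using inv inv' unfolding R_def by unfold_locales (auto simp: algebra_simps Units_def)
  have R_simps: "\<one>\<^bsub>R\<^esub> = 1" "x \<otimes>\<^bsub>R\<^esub> y = x * y" "carrier R = UNIV" "\<zero>\<^bsub>R\<^esub> = 0" for x y
    by (simp_all add: R_def)
  have pow: "x [^]\<^bsub>R\<^esub> k = x ^ k" for x :: 'a and k :: nat
    by (induction k) (simp_all add: R_simps mult.commute)
  have UNIV_R: "carrier (mult_of R) = UNIV - {0}"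
    by (simp add: R_simps)
  have "finite (carrier R)" by (simp add: R_simps)
  from R.finite_field_mult_group_has_gen[OF this] obtain a where "a \<in> carrier (mult_of R)"
      "carrier (mult_of R) = {a [^]\<^bsub>R\<^esub> i | i::nat. i \<in> UNIV}"
    by (rule bexE)
  then have a: "a \<noteq> 0" "UNIV - {0} = {a ^ i | i. i \<in> (UNIV :: nat set)}"
    unfolding UNIV_R pow by blast+
  show ?thesis
  proof (intro exI[of _ a] conjI allI impI)
    fix x :: 'a assume "x \<noteq> 0"
    then have "x \<in> {a ^ i | i. i \<in> (UNIV :: nat set)}"
      unfolding a(2)[symmetric] by simp
    then show "\<exists>k::nat. x = a ^ k" by simp
  qed fact
qed

text \<open>Multiplication by \<open>x\<close> permutes the nonzero elements, so their product is
  unchanged and can be cancelled.\<close>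

lemma finite_field_power_card_minus_1:
  fixes x :: "'a::{field,finite}"
  assumes "x \<noteq> 0"
  shows "x ^ (card (UNIV :: 'a set) - 1) = 1"
proof -
  have "(\<Prod>y\<in>UNIV-{0}. x * y) = x ^ (card (UNIV :: 'a set) - 1) * \<Prod>(UNIV-{0})"
    by (simp add: prod.distrib)
  moreover have "(\<Prod>y\<in>UNIV-{0}. x * y) = (\<Prod>y\<in>UNIV-{0}. y)"
    by (rule prod.reindex_bij_witness[of _ "\<lambda>y. y / x" "\<lambda>y. x * y"]) (use assms in auto)
  ultimately show ?thesis by (simp add: prod_zero_iff)
qed

text \<open>Coordinates for writing down characters: a choice of image \<open>w\<close> for the
  generator \<open>z\<close> gives the values \<open>w ^ d x\<close>. The exponents
  \<open>d x\<close> are additive only modulo the order of the cyclic group.\<close>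

lemma finite_field_discrete_log:
  obtains z :: "'a::{field,finite}" and d :: "'a \<Rightarrow> nat"
  where "z \<noteq> 0" "\<And>x. x \<noteq> 0 \<Longrightarrow> z ^ d x = x" "\<And>x. d x < card (UNIV :: 'a set) - 1"
    "\<And>x y. x \<noteq> 0 \<Longrightarrow> y \<noteq> 0 \<Longrightarrow> d (x * y) mod (card (UNIV :: 'a set) - 1) =
      (d x + d y) mod (card (UNIV :: 'a set) - 1)"
    "\<And>k. d (z ^ k) = k mod (card (UNIV :: 'a set) - 1)"
proof -
  define n where "n = card (UNIV :: 'a set) - 1"
  have n: "n > 0"
    using card_field_gt_1[where ?'a='a] by (simp add: n_def)
  obtain z :: 'a where z: "z \<noteq> 0" "\<And>x. x \<noteq> 0 \<Longrightarrow> \<exists>k::nat. x = z ^ k"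
    using finite_field_generator[where ?'a='a] by (elim exE conjE) simp
  have zn: "z ^ n = 1"
    using finite_field_power_card_minus_1[OF z(1)] by (simp add: n_def)
  have zmod: "z ^ (k mod n) = z ^ k" for k
  proof -
    have "z ^ k = z ^ (n * (k div n) + k mod n)" by simp
    also have "\<dots> = z ^ (k mod n)" by (simp only: power_add power_mult zn power_one mult_1)
    finally show ?thesis ..
  qed
  have img: "(\<lambda>k. z ^ k) ` {..<n} = UNIV - {0}"
  proof
    show "(\<lambda>k. z ^ k) ` {..<n} \<subseteq> UNIV - {0}" using z by auto
    show "UNIV - {0} \<subseteq> (\<lambda>k. z ^ k) ` {..<n}"
    proof
      fix x :: 'a assume "x \<in> UNIV - {0}"
      then obtain k where "x = z ^ k" using z(2)[of x] by auto
      then show "x \<in> (\<lambda>k. z ^ k) ` {..<n}"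
        using n zmod[of k] by (intro image_eqI[of _ _ "k mod n"]) auto
    qed
  qed
  \<comment> \<open>A surjection from \<open>n\<close> exponents onto the \<open>n\<close> nonzero
    elements is injective by counting.\<close>
  have "inj_on (\<lambda>k. z ^ k) {..<n}"
    by (rule eq_card_imp_inj_on) (simp_all add: img, simp add: n_def)
  then have inj: "j = k" if "z ^ j = z ^ k" "j < n" "k < n" for j k
    using that by (auto simp: inj_on_def)
  \<comment> \<open>The value at \<open>x = 0\<close> is a placeholder that keeps the bound
    \<open>d x < n\<close> valid for every \<open>x\<close>.\<close>
  define d where "d x = (if x = 0 then 0 else inv_into {..<n} (\<lambda>k. z ^ k) x)" for x
  have d: "z ^ d x = x" if "x \<noteq> 0" for x
    using f_inv_into_f[of x "\<lambda>k. z ^ k" "{..<n}"] that by (auto simp: img d_def)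
  have dn: "d x < n" for x
    using inv_into_into[of x "\<lambda>k. z ^ k" "{..<n}"] n by (auto simp: img d_def)
  have dz: "d (z ^ k) = k mod n" for k
    using inj[of "d (z ^ k)" "k mod n"] d[of "z ^ k"] dn n z zmod[of k] by auto
  have dmult: "d (x * y) mod n = (d x + d y) mod n" if "x \<noteq> 0" "y \<noteq> 0" for x y
    using dz[of "d x + d y"] d that by (simp add: power_add)
  show ?thesis
    by (rule that[of z d, OF z(1) d dn[unfolded n_def] dmult[unfolded n_def] dz[unfolded n_def]])
qed

section \<open>The group of multiplicative characters\<close>

lemma chars_zero: "\<chi> \<in> chars \<Longrightarrow> \<chi> 0 = 0"
  and chars_one: "\<chi> \<in> chars \<Longrightarrow> \<chi> 1 = 1"
  and chars_mult: "\<chi> \<in> chars \<Longrightarrow> \<chi> (x * y) = \<chi> x * \<chi> y"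
  by (cases "x = 0"; cases "y = 0"; auto simp: chars_def mult_char_def)+

lemma chars_eq_0_iff: "\<chi> \<in> chars \<Longrightarrow> \<chi> x = 0 \<longleftrightarrow> x = 0"
  by (metis chars_mult chars_one chars_zero mult_zero_left right_inverse zero_neq_one)

lemma chars_inverse: "\<chi> \<in> chars \<Longrightarrow> \<chi> (inverse x) = inverse (\<chi> x)"
  by (metis chars_mult chars_one chars_zero inverse_unique inverse_zero right_inverse)

lemma chars_divide: "\<chi> \<in> chars \<Longrightarrow> \<chi> (x / y) = \<chi> x / \<chi> y"
  by (simp add: chars_inverse chars_mult divide_inverse)

lemma chars_power: "\<chi> \<in> chars \<Longrightarrow> \<chi> (x ^ n) = \<chi> x ^ n"
  by (induction n) (simp_all add: chars_mult chars_one)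

lemma chars_minus_sq: "\<chi> \<in> chars \<Longrightarrow> \<chi> (- 1) * \<chi> (- 1) = 1"
  by (metis chars_mult chars_one minus_mult_minus mult_1)

lemma triv_char_in [simp]: "\<epsilon> \<in> chars"
  by (auto simp: chars_def mult_char_def triv_char_def)

lemma cmul_in [simp]: "\<chi> \<in> chars \<Longrightarrow> \<eta> \<in> chars \<Longrightarrow> \<chi> \<cdot> \<eta> \<in> chars"
  by (auto simp: chars_def mult_char_def cmul_def)

lemma cinv_in [simp]: "\<chi> \<in> chars \<Longrightarrow> cinv \<chi> \<in> chars"
  by (auto simp: chars_def mult_char_def cinv_def)

lemma cmul_apply: "(\<chi> \<cdot> \<eta>) x = \<chi> x * \<eta> x"
  by (simp add: cmul_def)

lemma cinv_apply: "cinv \<chi> x = inverse (\<chi> x)"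
  by (simp add: cinv_def)

lemma cmul_commute: "\<chi> \<cdot> \<eta> = \<eta> \<cdot> \<chi>"
  and cmul_assoc: "\<chi> \<cdot> \<eta> \<cdot> \<theta> = \<chi> \<cdot> (\<eta> \<cdot> \<theta>)"
  and cmul_left_commute: "\<chi> \<cdot> (\<eta> \<cdot> \<theta>) = \<eta> \<cdot> (\<chi> \<cdot> \<theta>)"
  and cinv_cinv [simp]: "cinv (cinv \<chi>) = \<chi>"
  and cinv_cmul: "cinv (\<chi> \<cdot> \<eta>) = cinv \<chi> \<cdot> cinv \<eta>"
  by (simp_all add: cmul_def cinv_def mult_ac)

lemmas cmul_ac = cmul_commute cmul_assoc cmul_left_commute

lemma cmul_triv [simp]:
  assumes "\<chi> \<in> chars"
  shows "\<epsilon> \<cdot> \<chi> = \<chi>" "\<chi> \<cdot> \<epsilon> = \<chi>"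
  using chars_zero[OF assms] by (simp_all add: cmul_def triv_char_def fun_eq_iff)

lemma cmul_cinv [simp]:
  assumes "\<chi> \<in> chars"
  shows "\<chi> \<cdot> cinv \<chi> = \<epsilon>" "cinv \<chi> \<cdot> \<chi> = \<epsilon>"
  using chars_eq_0_iff[OF assms] by (simp_all add: cmul_def cinv_def triv_char_def fun_eq_iff)

lemma cmul_cancel [simp]:
  "\<chi> \<in> chars \<Longrightarrow> \<eta> \<in> chars \<Longrightarrow> cinv \<chi> \<cdot> (\<chi> \<cdot> \<eta>) = \<eta>"
  "\<chi> \<in> chars \<Longrightarrow> \<eta> \<in> chars \<Longrightarrow> \<chi> \<cdot> (cinv \<chi> \<cdot> \<eta>) = \<eta>"
  by (simp_all flip: cmul_assoc)

lemma cinv_triv [simp]: "cinv \<epsilon> = \<epsilon>"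
  by (auto simp: cinv_def triv_char_def)

lemma cmul_eq_triv_iff:
  assumes "\<chi> \<in> chars" "\<eta> \<in> chars"
  shows "\<chi> \<cdot> \<eta> = \<epsilon> \<longleftrightarrow> \<eta> = cinv \<chi>"
  using assms by (metis cmul_cancel(1) cmul_cinv(1) cinv_in cmul_triv(2))

lemma cinv_eq_triv_iff: "cinv \<chi> = \<epsilon> \<longleftrightarrow> \<chi> = \<epsilon>"
  by (metis cinv_cinv cinv_triv)

lemma bij_betw_cmul:
  assumes "\<eta> \<in> chars"
  shows "bij_betw (\<lambda>\<chi>. \<eta> \<cdot> \<chi>) chars chars"
  by (rule bij_betwI[where g="\<lambda>\<chi>. cinv \<eta> \<cdot> \<chi>"]) (use assms in auto)

lemma sum_chars_reindex_cmul:
  "\<eta> \<in> chars \<Longrightarrow> (\<Sum>\<chi>\<in>chars. f (\<eta> \<cdot> \<chi>)) = (\<Sum>\<chi>\<in>chars. f \<chi>)"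
  by (rule sum.reindex_bij_betw[OF bij_betw_cmul])

text \<open>Every value of a character is 0 or a root of unity of order dividing \<open>?n\<close>,
  so the characters lie in a finite function space.\<close>

lemma finite_chars [simp]: "finite (chars :: ('a::{field,finite} \<Rightarrow> complex) set)"
proof -
  let ?n = "card (UNIV :: 'a set) - 1"
  have n: "?n > 0"
    using card_field_gt_1[where ?'a='a] by simp
  have "chars \<subseteq> PiE (UNIV :: 'a set) (\<lambda>_. insert 0 {w::complex. w ^ ?n = 1})"
  proof
    fix \<chi> :: "'a \<Rightarrow> complex" assume "\<chi> \<in> chars"
    then have "\<chi> x = 0 \<or> \<chi> x ^ ?n = 1" for x
      using finite_field_power_card_minus_1[of x] chars_power[of \<chi> x ?n]
      by (cases "x = 0") (simp_all add: chars_zero chars_one)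
    then show "\<chi> \<in> PiE UNIV (\<lambda>_. insert 0 {w. w ^ ?n = 1})"
      by auto
  qed
  then show ?thesis
    by (rule finite_subset)
      (use bij_betw_roots_unity[OF n] in \<open>auto intro!: finite_PiE dest: bij_betw_finite\<close>)
qed

section \<open>Existence of characters and orthogonality\<close>

text \<open>Because \<open>w ^ n = 1\<close>, exponents matter only modulo \<open>n\<close>, so
  additivity of \<open>d\<close> modulo \<open>n\<close> suffices. A primitive root \<open>w\<close>
  gives a faithful character, and \<open>w = - 1\<close> the quadratic one.\<close>

lemma char_from_root_of_unity:
  fixes d :: "'a::{field,finite} \<Rightarrow> nat" and w :: complex
  assumes "w ^ n = 1" "n > 0"
    and "\<And>x y. x \<noteq> 0 \<Longrightarrow> y \<noteq> 0 \<Longrightarrow> d (x * y) mod n = (d x + d y) mod n"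
  shows "(\<lambda>x. if x = 0 then 0 else w ^ d x) \<in> chars"
proof -
  have wmod: "w ^ (k mod n) = w ^ k" for k
  proof -
    have "w ^ k = w ^ (n * (k div n) + k mod n)" by simp
    also have "\<dots> = w ^ (k mod n)" by (simp only: power_add power_mult assms(1) power_one mult_1)
    finally show ?thesis ..
  qed
  have mult: "w ^ d (x * y) = w ^ d x * w ^ d y" if "x \<noteq> 0" "y \<noteq> 0" for x y
    using assms(3)[OF that] wmod[of "d (x * y)"] wmod[of "d x + d y"] by (simp add: power_add)
  have "w \<noteq> 0"
    using assms(1) \<open>n > 0\<close> by (auto simp: power_0_left)
  then have "w ^ d 1 = 1"
    using mult[of 1 1] by simp
  then show ?thesis using mult by (auto simp: chars_def mult_char_def)
qed

text \<open>The character that sends the generator to a primitive root of unity is injective on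
  nonzero elements, hence separates \<open>x\<close> from 1.\<close>

lemma exists_char_neq_1:
  fixes x :: "'a::{field,finite}"
  assumes "x \<noteq> 0" "x \<noteq> 1"
  obtains \<chi> where "\<chi> \<in> chars" "\<chi> x \<noteq> 1"
proof -
  let ?n = "card (UNIV :: 'a set) - 1"
  obtain z :: 'a and d where d: "z \<noteq> 0" "\<And>x. x \<noteq> 0 \<Longrightarrow> z ^ d x = x" "\<And>x. d x < ?n"
    "\<And>x y. x \<noteq> 0 \<Longrightarrow> y \<noteq> 0 \<Longrightarrow> d (x * y) mod ?n = (d x + d y) mod ?n"
    using finite_field_discrete_log[where ?'a='a] by metis
  define w where "w = cis (2 * pi / ?n)"
  have w: "w ^ k = cis (2 * pi * k / ?n)" for k
    by (simp add: w_def Complex.DeMoivre mult_ac)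
  have n: "?n > 0" using d(3)[of 0] by linarith
  then have wn: "w ^ ?n = 1" by (simp only: w) simp
  have "d x \<noteq> 0" using d(2)[of x] assms by (metis power_0)
  then have "w ^ d x \<noteq> w ^ 0"
    using inj_onD[OF bij_betw_imp_inj_on[OF bij_betw_roots_unity[OF n]], of "d x" 0] d(3)[of x] n
    unfolding w by auto
  then have "w ^ d x \<noteq> 1" by simp
  then show ?thesis
    using that[OF char_from_root_of_unity[OF wn n d(4)]] assms by simp
qed

lemma sum_char_nontriv:
  fixes \<chi> :: "'a::{field,finite} \<Rightarrow> complex"
  assumes "\<chi> \<in> chars"  "\<chi> \<noteq> \<epsilon>"
  shows "(\<Sum>x\<in>UNIV. \<chi> x) = 0"
proof -
  obtain a where a: "a \<noteq> 0" "\<chi> a \<noteq> 1"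
  proof -
    obtain a where "\<chi> a \<noteq> \<epsilon> a" using assms(2) by blast
    then show ?thesis
      using that[of a] chars_zero[OF assms(1)] by (cases "a = 0") (auto simp: triv_char_def)
  qed
  have "(\<Sum>x\<in>UNIV. \<chi> x) = (\<Sum>x\<in>UNIV. \<chi> (a * x))"
    by (rule sum.reindex_bij_witness[of _ "\<lambda>x. a * x" "\<lambda>x. x / a"]) (use a in auto)
  also have "\<dots> = \<chi> a * (\<Sum>x\<in>UNIV. \<chi> x)"
    using assms by (simp add: chars_mult sum_distrib_left)
  finally show ?thesis using a by simp
qed

lemma sum_triv_char: "(\<Sum>x\<in>(UNIV :: 'a::{field,finite} set). \<epsilon> x) = order_UNIV TYPE('a) - 1"
proof -
  have "(\<Sum>x\<in>(UNIV :: 'a set). \<epsilon> x) = (\<Sum>x\<in>UNIV - {0::'a}. 1)"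
    by (rule sum.mono_neutral_cong_right) (auto simp: triv_char_def)
  also have "\<dots> = order_UNIV TYPE('a) - 1"
    using card_field_gt_1[where ?'a='a] by (simp add: of_nat_diff)
  finally show ?thesis .
qed

text \<open>For \<open>x \<noteq> 1\<close>, multiplying all characters by one that separates
  \<open>x\<close> from 1 forces the sum to vanish. The value at 1, which is the number of
  characters, then comes from summing \<open>\<chi> x\<close> over all \<open>x\<close> and all
  \<open>\<chi>\<close> in both orders.\<close>

lemma sum_chars:
  fixes x :: "'a::{field,finite}"
  shows "(\<Sum>\<chi>\<in>chars. \<chi> x) = (if x = 1 then order_UNIV TYPE('a) - 1 else 0)"
proof -
  have *: "(\<Sum>\<chi>\<in>chars. \<chi> x) = 0" if x: "x \<noteq> 1" for x :: 'a
  proof (cases "x = 0")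
    case False
    obtain \<eta> where \<eta>: "\<eta> \<in> chars" "\<eta> x \<noteq> 1"
      by (rule exists_char_neq_1[OF False x])
    have "(\<Sum>\<chi>\<in>chars. \<chi> x) = \<eta> x * (\<Sum>\<chi>\<in>chars. \<chi> x)"
      using sum_chars_reindex_cmul[OF \<eta>(1), of "\<lambda>\<chi>. \<chi> x"]
      by (simp add: cmul_apply sum_distrib_left)
    then show ?thesis using \<eta> by simp
  qed (simp add: chars_zero)
  have "(\<Sum>\<chi>\<in>chars. \<chi> (1::'a)) = (\<Sum>x\<in>{1}. \<Sum>\<chi>\<in>chars. \<chi> (x::'a))"
    by (simp only: sum.insert sum.empty finite.emptyI empty_iff not_False_eq_True add_0_right)
  also have "\<dots> = (\<Sum>x\<in>UNIV. \<Sum>\<chi>\<in>chars. \<chi> (x::'a))"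
    by (rule sum.mono_neutral_left) (simp_all add: *)
  also have "\<dots> = (\<Sum>\<chi>\<in>chars. \<Sum>x\<in>UNIV. \<chi> (x::'a))"
    by (rule sum.swap)
  also have "\<dots> = (\<Sum>\<chi>\<in>{\<epsilon>}. \<Sum>x\<in>UNIV. \<chi> (x::'a))"
    by (rule sum.mono_neutral_right) (use sum_char_nontriv in \<open>simp_all, blast\<close>)
  also have "\<dots> = order_UNIV TYPE('a) - 1" by (simp add: sum_triv_char)
  finally show ?thesis using *[of x] by (cases "x = 1") simp_all
qed

section \<open>Odd characteristic and the quadratic character\<close>

lemma char_two_nonzero:
  assumes "CHAR('a::{field,finite}) \<noteq> 2"
  shows "(2::'a) \<noteq> 0"
proof
  assume "(2::'a) = 0"
  then have "of_nat 2 = (0::'a)" by simp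
  then have "CHAR('a) dvd 2" by (simp only: of_nat_eq_0_iff_char_dvd)
  then have "CHAR('a) \<le> 2" "CHAR('a) \<noteq> 0"
    by (auto dest: dvd_imp_le intro!: Nat.gr0I)
  then have "CHAR('a) = 1"
    using assms by linarith
  then show False
    using CHAR_not_1[where ?'a='a] by simp
qed

text \<open>An odd exponent would give \<open>- 1\<close> as the power of \<open>- 1\<close>,
  whereas the power is 1 and \<open>1 \<noteq> - 1\<close>.\<close>

lemma odd_card:
  assumes "(2::'a::{field,finite}) \<noteq> 0"
  shows "even (card (UNIV :: 'a set) - 1)"
proof (rule ccontr)
  assume "odd (card (UNIV :: 'a set) - 1)"
  then have "(-1 :: 'a) ^ (card (UNIV :: 'a set) - 1) = - 1" by simp
  moreover have "(-1 :: 'a) ^ (card (UNIV :: 'a set) - 1) = 1"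
    by (rule finite_field_power_card_minus_1) simp
  ultimately have "(1::'a) + 1 = 0" by (metis add.right_inverse)
  then show False using assms by simp
qed

text \<open>Squares are the elements with even discrete logarithm, so \<phi> is the character with
  value \<open>- 1\<close> at the generator. A character of square \<epsilon> takes the value 1 or
  \<open>- 1\<close> there, and this value determines it.\<close>

lemma quad_char_order_two:
  assumes "(2::'a::{field,finite}) \<noteq> 0"
  shows "(\<phi> :: 'a \<Rightarrow> complex) \<in> chars"
    and "(\<phi> :: 'a \<Rightarrow> complex) \<noteq> \<epsilon>"
    and "\<And>\<chi> :: 'a \<Rightarrow> complex. \<chi> \<in> chars \<Longrightarrow> \<chi> \<cdot> \<chi> = \<epsilon> \<Longrightarrow> \<chi> = \<epsilon> \<or> \<chi> = \<phi>"
proof -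
  let ?n = "card (UNIV :: 'a set) - 1"
  obtain z :: 'a and d where d: "z \<noteq> 0" "\<And>x. x \<noteq> 0 \<Longrightarrow> z ^ d x = x" "\<And>x. d x < ?n"
    "\<And>x y. x \<noteq> 0 \<Longrightarrow> y \<noteq> 0 \<Longrightarrow> d (x * y) mod ?n = (d x + d y) mod ?n"
    "\<And>k. d (z ^ k) = k mod ?n"
    using finite_field_discrete_log[where ?'a='a] by metis
  have n: "even ?n" using odd_card[OF assms] .
  have sq: "(\<exists>y. y ^ 2 = x) \<longleftrightarrow> even (d x)" if "x \<noteq> 0" for x
  proof
    assume "\<exists>y. y ^ 2 = x"
    then obtain y where y: "y ^ 2 = x" by blast
    then have "y \<noteq> 0" using that by auto
    then have "x = z ^ (2 * d y)" using d(2)[of y] y by (metis power_mult mult.commute)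
    then have "d x = (2 * d y) mod ?n" using d(5) by metis
    \<comment> \<open>Reduction modulo \<open>?n\<close> preserves parity because \<open>?n\<close>
      is even.\<close>
    then show "even (d x)" using n by (simp add: dvd_mod_iff)
  next
    assume "even (d x)"
    then have "(z ^ (d x div 2)) ^ 2 = x"
      using d(2)[OF that] by (simp flip: power_mult)
    then show "\<exists>y. y ^ 2 = x" ..
  qed
  have \<phi>: "(\<phi> :: 'a \<Rightarrow> complex) = (\<lambda>x. if x = 0 then 0 else (- 1) ^ d x)"
    using sq by (auto simp: quad_char_def fun_eq_iff)
  show "(\<phi> :: 'a \<Rightarrow> complex) \<in> chars"
    unfolding \<phi> by (rule char_from_root_of_unity[OF _ _ d(4)]) (use n card_field_gt_1[where ?'a='a] in auto)
  \<comment> \<open>Excluding \<open>?n = 1\<close> ensures that \<open>d z\<close>, which is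
    \<open>1 mod ?n\<close>, equals 1 and not 0.\<close>
  have "?n \<noteq> 1" using n by (metis odd_one)
  then have "?n > 1" using d(3)[of 0] by linarith
  then have "d z = 1" using d(5)[of 1] by simp
  then have \<phi>z: "\<phi> z = - 1" using d(1) by (simp add: \<phi>)
  then show "(\<phi> :: 'a \<Rightarrow> complex) \<noteq> \<epsilon>"
    using d(1) by (metis one_neq_neg_one triv_char_def)
  show "\<chi> = \<epsilon> \<or> \<chi> = \<phi>" if \<chi>: "\<chi> \<in> chars" "\<chi> \<cdot> \<chi> = \<epsilon>" for \<chi> :: "'a \<Rightarrow> complex"
  proof -
    have \<chi>z: "\<chi> z * \<chi> z = 1"
      using fun_cong[OF \<chi>(2), of z] d(1) by (simp add: cmul_apply triv_char_def)
    have *: "\<chi> x = (if x = 0 then 0 else \<chi> z ^ d x)" for x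
      using d(2)[of x] chars_power[OF \<chi>(1), of z "d x"] chars_zero[OF \<chi>(1)]
      by (cases "x = 0") auto
    consider "\<chi> z = 1" | "\<chi> z = - 1"
      using \<chi>z by (auto simp: square_eq_1_iff)
    then show ?thesis
    proof cases
      assume "\<chi> z = 1"
      then have "\<chi> x = \<epsilon> x" for x by (subst *) (simp add: triv_char_def)
      then show ?thesis by blast
    next
      assume "\<chi> z = - 1"
      then have "\<chi> x = \<phi> x" for x by (subst *) (simp add: \<phi>)
      then show ?thesis by blast
    qed
  qed
qed

section \<open>Gauss sums\<close>

text \<open>The condition \<open>psi_0\<close> excludes the zero function, which satisfies the other
  two conditions on \<psi>. The parameter \<open>q\<close> names the field order as a complex
  number, so that simplification can rewrite to it.\<close>

locale additive_character =
  fixes \<psi> :: "'a::{field,finite} \<Rightarrow> complex" and q :: complex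
  assumes card_eq [simp]: "order_UNIV TYPE('a) = q"
    and psi_add: "\<psi> (x + y) = \<psi> x * \<psi> y"
    and psi_0: "\<psi> 0 = 1"
    and psi_nontriv: "\<exists>x. \<psi> x \<noteq> 1"
begin

abbreviation "g \<equiv> gauss \<psi>"
abbreviation "g0 \<equiv> gauss0 \<psi>"

lemma q_nonzero: "q \<noteq> 0" "q - 1 \<noteq> 0" "1 - q \<noteq> 0"
  using card_field_gt_1[where ?'a='a] by (auto simp flip: card_eq)

lemma sum_psi: "(\<Sum>x\<in>UNIV. \<psi> x) = 0"
proof -
  obtain a where a: "\<psi> a \<noteq> 1" using psi_nontriv by (rule exE)
  have "(\<Sum>x\<in>UNIV. \<psi> x) = (\<Sum>x\<in>UNIV. \<psi> (a + x))"
    by (rule sum.reindex_bij_witness[of _ "\<lambda>x. a + x" "\<lambda>x. x - a"]) simp_all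
  also have "\<dots> = \<psi> a * (\<Sum>x\<in>UNIV. \<psi> x)"
    by (simp add: psi_add sum_distrib_left)
  finally show ?thesis using a by simp
qed

lemma gauss_eq:
  assumes "\<eta> \<in> chars"
  shows "g \<eta> = - (\<Sum>x\<in>UNIV. \<psi> x * \<eta> x)"
  unfolding gauss_def
  by (subst sum.mono_neutral_left[of UNIV]) (simp_all add: chars_zero[OF assms])

lemma gauss_triv: "g \<epsilon> = 1"
proof -
  have "g \<epsilon> = - (\<Sum>x\<in>UNIV - {0}. \<psi> x)"
    unfolding gauss_def by (auto simp: triv_char_def intro!: sum.cong)
  also have "(\<Sum>x\<in>UNIV - {0}. \<psi> x) = (\<Sum>x\<in>UNIV. \<psi> x) - \<psi> 0"
    by (simp add: sum_diff1)
  finally show ?thesis by (simp add: sum_psi psi_0)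
qed

lemma gauss0_triv: "g0 \<epsilon> = q"
  by (simp add: gauss0_def delta_def gauss_triv)

lemma gauss0_nontriv: "\<eta> \<noteq> \<epsilon> \<Longrightarrow> g0 \<eta> = g \<eta>"
  by (simp add: gauss0_def delta_def)

text \<open>For \<open>a \<noteq> 0\<close> this is a rescaling of the variable. For
  \<open>a = 0\<close> both sides vanish when \<eta> is nontrivial, so for such \<eta> the formula
  expands a character as a Gauss sum at every argument.\<close>

lemma gauss_twist:
  assumes "\<eta> \<in> chars" "a \<noteq> 0 \<or> \<eta> \<noteq> \<epsilon>"
  shows "(\<Sum>x\<in>UNIV. \<psi> (a * x) * \<eta> x) = - cinv \<eta> a * g \<eta>"
proof (cases "a = 0")
  case True
  then show ?thesis
    using assms sum_char_nontriv[of \<eta>] by (simp add: psi_0 cinv_apply chars_zero[OF assms(1)])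
next
  case False
  have "(\<Sum>x\<in>UNIV. \<psi> (a * x) * \<eta> x) = (\<Sum>x\<in>UNIV. \<psi> x * \<eta> (x / a))"
    by (rule sum.reindex_bij_witness[of _ "\<lambda>x. x / a" "\<lambda>x. a * x"]) (use False in simp_all)
  also have "\<dots> = (\<Sum>x\<in>UNIV. cinv \<eta> a * (\<psi> x * \<eta> x))"
    by (simp add: chars_divide[OF assms(1)] cinv_apply field_simps)
  also have "\<dots> = cinv \<eta> a * (\<Sum>x\<in>UNIV. \<psi> x * \<eta> x)"
    by (simp add: sum_distrib_left)
  finally show ?thesis by (simp add: gauss_eq[OF assms(1)])
qed

section \<open>Jacobi sums and reflection of Gauss sums\<close>

text \<open>The substitution \<open>w = inverse u - 1\<close> turns the summand into
  \<open>c w\<close>, with \<open>w\<close> running over everything except \<open>- 1\<close>; the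
  complete sum is 0.\<close>

lemma jacobi_sum_inverse:
  assumes "c \<in> chars" "c \<noteq> \<epsilon>"
  shows "(\<Sum>u\<in>(UNIV :: 'a set). cinv c u * c (1 - u)) = - c (- 1)"
proof -
  have "(\<Sum>u\<in>(UNIV :: 'a set). cinv c u * c (1 - u)) = (\<Sum>u\<in>UNIV - {0}. c (inverse u - 1))"
  proof (rule sum.mono_neutral_cong_right)
    fix u :: 'a assume "u \<in> UNIV - {0}"
    then have "inverse u - 1 = (1 - u) / u" by (simp add: field_simps)
    then show "cinv c u * c (1 - u) = c (inverse u - 1)"
      by (simp only: chars_divide[OF assms(1)] cinv_apply) (simp only: divide_inverse mult.commute)
  qed (simp_all add: cinv_apply chars_zero[OF assms(1)])
  also have "\<dots> = (\<Sum>w\<in>UNIV - {- 1}. c w)"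
  proof (rule sum.reindex_bij_witness[of _ "\<lambda>w. inverse (1 + w)" "\<lambda>u. inverse u - 1"])
    fix w :: 'a assume "w \<in> UNIV - {- 1}"
    then show "inverse (1 + w) \<in> UNIV - {0}"
      by (simp add: add_eq_0_iff)
  qed simp_all
  also have "\<dots> = (\<Sum>w\<in>UNIV. c w) - c (- 1)"
    by (simp add: sum_diff1)
  finally show ?thesis using sum_char_nontriv[OF assms] by simp
qed

text \<open>The analogue of the beta integral. The product is grouped by \<open>s = x + y\<close>;
  for \<open>s \<noteq> 0\<close> the scaling \<open>x = s * u\<close> factors out
  \<open>(a \<cdot> c) s\<close>. The part \<open>s = 0\<close> contributes only if
  \<open>a \<cdot> c\<close> is trivial, and then it is exactly accounted for by the factor
  \<open>q\<close> in \<open>g0\<close>.\<close>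

lemma gauss_jacobi:
  assumes "a \<in> chars" "c \<in> chars" "c \<noteq> \<epsilon>"
  shows "g a * g c = - g0 (a \<cdot> c) * (\<Sum>u\<in>UNIV. a u * c (1 - u))"
proof -
  define J where "J = (\<Sum>u\<in>UNIV. a u * c (1 - u))"
  define T where "T s = (\<Sum>x\<in>UNIV. a x * c (s - x))" for s
  have "g a * g c = (\<Sum>x\<in>UNIV. \<Sum>y\<in>UNIV. (\<psi> x * a x) * (\<psi> y * c y))"
    by (simp add: gauss_eq assms sum_product)
  also have "\<dots> = (\<Sum>x\<in>UNIV. \<Sum>s\<in>UNIV. \<psi> s * (a x * c (s - x)))"
  proof (rule sum.cong)
    fix x
    show "(\<Sum>y\<in>UNIV. (\<psi> x * a x) * (\<psi> y * c y)) = (\<Sum>s\<in>UNIV. \<psi> s * (a x * c (s - x)))"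
      by (rule sum.reindex_bij_witness[of _ "\<lambda>s. s - x" "\<lambda>y. x + y"])
        (simp_all add: psi_add)
  qed simp
  also have "\<dots> = (\<Sum>s\<in>UNIV. \<psi> s * T s)"
    by (subst sum.swap) (simp add: T_def sum_distrib_left)
  also have "\<dots> = (\<Sum>s\<in>UNIV - {0}. \<psi> s * T s) + T 0"
    by (simp add: sum_diff1 psi_0)
  also have "(\<Sum>s\<in>UNIV - {0}. \<psi> s * T s) = (\<Sum>s\<in>UNIV - {0}. J * (\<psi> s * (a \<cdot> c) s))"
  proof (rule sum.cong)
    fix s :: 'a assume "s \<in> UNIV - {0}"
    then have s: "s \<noteq> 0" by simp
    have "T s = (\<Sum>u\<in>UNIV. a (s * u) * c (s - s * u))"
      unfolding T_def
      by (rule sum.reindex_bij_witness[of _ "\<lambda>u. s * u" "\<lambda>x. x / s"]) (use s in simp_all)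
    also have "\<dots> = (\<Sum>u\<in>UNIV. (a \<cdot> c) s * (a u * c (1 - u)))"
    proof (rule sum.cong)
      fix u
      have "s - s * u = s * (1 - u)" by (simp add: algebra_simps)
      then show "a (s * u) * c (s - s * u) = (a \<cdot> c) s * (a u * c (1 - u))"
        by (simp only: chars_mult[OF assms(1)] chars_mult[OF assms(2)] cmul_apply mult_ac)
    qed simp
    finally show "\<psi> s * T s = J * (\<psi> s * (a \<cdot> c) s)"
      by (simp add: J_def sum_distrib_left mult_ac)
  qed simp
  also have "\<dots> = - J * g (a \<cdot> c)"
    by (simp add: gauss_def sum_negf flip: sum_distrib_left)
  also have "T 0 = c (- 1) * (\<Sum>x\<in>UNIV. (a \<cdot> c) x)"
  proof -
    have "a x * c (0 - x) = c (- 1) * (a \<cdot> c) x" for x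
      using chars_mult[OF assms(2), of "- 1" x] by (simp add: cmul_apply)
    then show ?thesis unfolding T_def by (simp add: sum_distrib_left)
  qed
  finally have *: "g a * g c = - J * g (a \<cdot> c) + c (- 1) * (\<Sum>x\<in>UNIV. (a \<cdot> c) x)" .
  show ?thesis
  proof (cases "a \<cdot> c = \<epsilon>")
    case False
    then show ?thesis
      using * sum_char_nontriv[of "a \<cdot> c"] assms by (simp add: gauss0_nontriv J_def)
  next
    case True
    then have "a = cinv c"
      using cmul_eq_triv_iff[OF assms(2,1)] by (simp add: cmul_commute)
    then have "J = - c (- 1)"
      using jacobi_sum_inverse[OF assms(2,3)] by (simp add: J_def)
    then show ?thesis
      using * True unfolding J_def[symmetric]
      by (simp add: gauss_triv gauss0_triv sum_triv_char algebra_simps)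
  qed
qed

text \<open>The Jacobi formula for two mutually inverse characters. Using \<open>g0\<close> for just
  one of the two factors makes the trivial character fit the same formula.\<close>

lemma gauss_reflect:
  assumes "\<eta> \<in> chars"
  shows "g \<eta> * g0 (cinv \<eta>) = q * \<eta> (- 1)"
proof (cases "\<eta> = \<epsilon>")
  case True
  then show ?thesis by (simp add: gauss_triv gauss0_triv triv_char_def)
next
  case False
  then have "g (cinv \<eta>) * g \<eta> = q * \<eta> (- 1)"
    using gauss_jacobi[of "cinv \<eta>" \<eta>] jacobi_sum_inverse[of \<eta>] assms
    by (simp add: gauss0_triv)
  then show ?thesis
    using False by (simp add: gauss0_nontriv cinv_eq_triv_iff mult.commute)
qed

lemma gauss_nonzero:
  assumes "\<eta> \<in> chars"
  shows "g \<eta> \<noteq> 0" "g0 \<eta> \<noteq> 0"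
proof -
  have "\<eta> (- 1) \<noteq> 0" using chars_eq_0_iff[OF assms] by simp
  then show "g \<eta> \<noteq> 0"
    using gauss_reflect[OF assms] q_nonzero by auto
  then show "g0 \<eta> \<noteq> 0"
    using q_nonzero by (simp add: gauss0_def)
qed

text \<open>Reflection solved for \<open>g0\<close>: it moves denominators of hypergeometric
  coefficients into numerators, where they can be expanded as sums over the field.\<close>

lemma inverse_gauss0:
  assumes "\<eta> \<in> chars"
  shows "1 / g0 \<eta> = g (cinv \<eta>) * \<eta> (- 1) / q"
proof -
  have "g (cinv \<eta>) * g0 \<eta> = q * inverse (\<eta> (- 1))"
    using gauss_reflect[of "cinv \<eta>"] assms by (simp add: cinv_apply)
  moreover have "inverse (\<eta> (- 1)) = \<eta> (- 1)"
    using chars_inverse[OF assms, of "- 1"] by simp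
  moreover have "\<eta> (- 1) * \<eta> (- 1) = 1"
    by (rule chars_minus_sq[OF assms])
  ultimately have "g (cinv \<eta>) * \<eta> (- 1) * g0 \<eta> = q"
    by (metis mult.assoc mult.commute mult_1)
  then show ?thesis
    using gauss_nonzero[OF assms] q_nonzero by (simp add: field_simps)
qed

text \<open>Needed when orthogonality replaces a summation character by an inverse one: denominator
  symbols then become numerator symbols with inverted parameter. The signs
  \<open>\<gamma> (- 1)\<close> occur twice and cancel.\<close>

lemma poch0_reflect:
  assumes "\<gamma> \<in> chars" "\<mu> \<in> chars"
  shows "1 / poch0 \<psi> \<gamma> (cinv \<mu>) = \<mu> (- 1) * poch \<psi> (cinv \<gamma>) \<mu>"
proof -
  have 1: "1 / g0 (\<gamma> \<cdot> cinv \<mu>) = g (cinv \<gamma> \<cdot> \<mu>) * (\<gamma> (- 1) * inverse (\<mu> (- 1))) / q"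
    using inverse_gauss0[of "\<gamma> \<cdot> cinv \<mu>"] assms by (simp add: cinv_cmul cmul_apply cinv_apply)
  have 2: "g0 \<gamma> = q * \<gamma> (- 1) / g (cinv \<gamma>)"
    using inverse_gauss0[of \<gamma>] assms gauss_nonzero[of \<gamma>] gauss_nonzero[of "cinv \<gamma>"] q_nonzero
      chars_minus_sq[of \<gamma>]
    by (simp add: field_simps)
  have 3: "inverse (\<mu> (- 1)) = \<mu> (- 1)"
    using chars_inverse[OF assms(2), of "- 1"] by simp
  have "1 / poch0 \<psi> \<gamma> (cinv \<mu>) = g0 \<gamma> * (1 / g0 (\<gamma> \<cdot> cinv \<mu>))"
    by (simp add: poch0_def)
  also have "\<dots> = (\<gamma> (- 1) * \<gamma> (- 1)) * (\<mu> (- 1) * g (cinv \<gamma> \<cdot> \<mu>) / g (cinv \<gamma>))"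
    unfolding 1 2 3 using q_nonzero by (simp add: field_simps)
  finally show ?thesis using chars_minus_sq[OF assms(1)] by (simp add: poch_def)
qed

text \<open>The exponential series, as Mellin inversion of the Gauss sum: after
  \<open>inverse_gauss0\<close>, orthogonality of characters keeps only \<open>x = - w\<close>. At
  \<open>w = 0\<close> all characters vanish, so the exponential is not recovered there.\<close>

lemma sum_chars_div_gauss0:
  "(\<Sum>\<nu>\<in>chars. \<nu> w / g0 \<nu>) = (if w = 0 then 0 else - (q - 1) / q * \<psi> (- w))"
proof (cases "w = 0")
  case True
  then show ?thesis by (simp add: chars_zero)
next
  case False
  have "(\<Sum>\<nu>\<in>chars. \<nu> w / g0 \<nu>) = (\<Sum>\<nu>\<in>chars. \<Sum>x\<in>UNIV. - (\<psi> x / q) * \<nu> (- w / x))"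
  proof (rule sum.cong)
    fix \<nu> :: "'a \<Rightarrow> complex" assume \<nu>: "\<nu> \<in> chars"
    have "\<nu> w / g0 \<nu> = \<nu> w * (1 / g0 \<nu>)" by simp
    also have "\<dots> = - (\<Sum>x\<in>UNIV. \<psi> x * inverse (\<nu> x)) * \<nu> (- 1) * \<nu> w / q"
      unfolding inverse_gauss0[OF \<nu>] gauss_eq[OF cinv_in[OF \<nu>]] by (simp add: cinv_apply)
    also have "\<dots> = (\<Sum>x\<in>UNIV. - (\<psi> x / q) * (\<nu> (- 1) * \<nu> w * inverse (\<nu> x)))"
      by (simp add: sum_distrib_left sum_distrib_right sum_divide_distrib sum_negf mult_ac)
    also have "\<dots> = (\<Sum>x\<in>UNIV. - (\<psi> x / q) * \<nu> (- w / x))"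
    proof (rule sum.cong)
      fix x
      have "- w / x = - 1 * w * inverse x" by (simp add: divide_inverse)
      then show "- (\<psi> x / q) * (\<nu> (- 1) * \<nu> w * inverse (\<nu> x)) = - (\<psi> x / q) * \<nu> (- w / x)"
        by (simp only: chars_mult[OF \<nu>] chars_inverse[OF \<nu>])
    qed simp
    finally show "\<nu> w / g0 \<nu> = (\<Sum>x\<in>UNIV. - (\<psi> x / q) * \<nu> (- w / x))" .
  qed simp
  also have "\<dots> = (\<Sum>x\<in>UNIV. - (\<psi> x / q) * (\<Sum>\<nu>\<in>chars. \<nu> (- w / x)))"
    by (subst sum.swap) (simp add: sum_distrib_left)
  also have "\<dots> = (\<Sum>x\<in>{- w}. - (\<psi> x / q) * (\<Sum>\<nu>\<in>chars. \<nu> (- w / x)))"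
  proof (rule sum.mono_neutral_right)
    show "\<forall>x\<in>UNIV - {- w}. - (\<psi> x / q) * (\<Sum>\<nu>\<in>chars. \<nu> (- w / x)) = 0"
    proof
      fix x assume "x \<in> UNIV - {- w}"
      then have "- w / x \<noteq> 1" using False by (cases "x = 0") (auto simp: field_simps)
      then show "- (\<psi> x / q) * (\<Sum>\<nu>\<in>chars. \<nu> (- w / x)) = 0"
        by (simp only: sum_chars if_False mult_zero_right)
    qed
  qed simp_all
  also have "\<dots> = - (q - 1) / q * \<psi> (- w)"
    using False q_nonzero by (simp add: sum_chars field_simps)
  finally show ?thesis using False by simp
qed

end

section \<open>Confluent hypergeometric functions\<close>

definition hyp1F1 :: "('a::{field,finite} \<Rightarrow> complex) \<Rightarrow> ('a \<Rightarrow> complex) \<Rightarrow> ('a \<Rightarrow> complex) \<Rightarrow> 'a \<Rightarrow> complex" where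
  "hyp1F1 \<psi> \<beta> \<gamma> t = 1 / (1 - of_nat (card (UNIV :: 'a set))) *
     (\<Sum>\<nu>\<in>chars. poch \<psi> \<beta> \<nu> / (poch0 \<psi> \<gamma> \<nu> * poch0 \<psi> \<epsilon> \<nu>) * \<nu> t)"

text \<open>The analogue of a Bessel function; at a nonzero argument it is a twisted Kloosterman
  sum, by \<open>hyp0F1_integral\<close>.\<close>

definition hyp0F1 :: "('a::{field,finite} \<Rightarrow> complex) \<Rightarrow> ('a \<Rightarrow> complex) \<Rightarrow> 'a \<Rightarrow> complex" where
  "hyp0F1 \<psi> \<gamma> t = 1 / (1 - of_nat (card (UNIV :: 'a set))) *
     (\<Sum>\<nu>\<in>chars. \<nu> t / (poch0 \<psi> \<gamma> \<nu> * poch0 \<psi> \<epsilon> \<nu>))"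

section \<open>Sums over squares, quadratic Gauss sums and a Salie-type identity\<close>

text \<open>The element \<open>s\<close> has \<open>1 + \<phi> s\<close> square roots. This includes
  \<open>s = 0\<close>, where \<phi> is 0 and the only root is 0.\<close>

lemma sum_over_squares:
  fixes f :: "'a::{field,finite} \<Rightarrow> complex"
  assumes "(2::'a) \<noteq> 0"
  shows "(\<Sum>v\<in>UNIV. f (v ^ 2)) = (\<Sum>s\<in>UNIV. (1 + \<phi> s) * f s)"
proof -
  have card: "of_nat (card {v::'a. v ^ 2 = s}) = 1 + (\<phi> s :: complex)" for s
  proof (cases "\<exists>y. y ^ 2 = s")
    case True
    then obtain y where y: "y ^ 2 = s" by blast
    have set: "{v. v ^ 2 = s} = {y, - y}"
      using y by (auto simp: power2_eq_iff)
    have "y \<noteq> - y" if "y \<noteq> 0"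
    proof
      assume "y = - y"
      then have "2 * y = 0" by (metis add.right_inverse mult_2)
      then show False using that assms by simp
    qed
    then show ?thesis
      unfolding set using y by (cases "y = 0") (auto simp: quad_char_def)
  next
    case False
    then have "{v. v ^ 2 = s} = {}" by blast
    moreover have "s \<noteq> 0" using False by (metis zero_power2)
    ultimately show ?thesis using False by (simp add: quad_char_def)
  qed
  have "(\<Sum>v\<in>UNIV. f (v ^ 2)) = (\<Sum>s\<in>UNIV. \<Sum>v\<in>{v\<in>UNIV. v ^ 2 = s}. f (v ^ 2))"
    by (rule sum.group[symmetric]) simp_all
  also have "\<dots> = (\<Sum>s\<in>UNIV. of_nat (card {v::'a. v ^ 2 = s}) * f s)"
    by (simp cong: conj_cong)
  finally show ?thesis by (simp only: card)
qed

locale odd_additive_character = additive_character +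
  assumes two: "(2 :: 'a) \<noteq> 0"
begin

lemma quad_char_in [simp]: "(\<phi> :: 'a \<Rightarrow> complex) \<in> chars"
  by (rule quad_char_order_two(1)[OF two])

lemma quad_char_nontriv: "(\<phi> :: 'a \<Rightarrow> complex) \<noteq> \<epsilon>"
  by (rule quad_char_order_two(2)[OF two])

lemma cinv_quad [simp]: "cinv (\<phi> :: 'a \<Rightarrow> complex) = \<phi>"
  by (rule ext) (simp add: cinv_def quad_char_def)

lemma quad_quad [simp]: "\<phi> \<cdot> \<phi> = (\<epsilon> :: 'a \<Rightarrow> complex)"
  using cmul_cinv(1)[OF quad_char_in] by simp

lemma four_nonzero: "(4 :: 'a) \<noteq> 0"
proof -
  have "(2 :: 'a) * 2 \<noteq> 0" using two by (metis mult_eq_0_iff)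
  then show ?thesis by simp
qed

lemma quadratic_gauss_sum:
  assumes "s \<noteq> 0"
  shows "(\<Sum>v\<in>UNIV. \<psi> (s * v ^ 2)) = - \<phi> s * g \<phi>"
proof -
  have "(\<Sum>v\<in>UNIV. \<psi> (s * v ^ 2)) = (\<Sum>t\<in>UNIV. (1 + \<phi> t) * \<psi> (s * t))"
    by (rule sum_over_squares[OF two])
  also have "\<dots> = (\<Sum>t\<in>UNIV. \<psi> (s * t)) + (\<Sum>t\<in>UNIV. \<psi> (s * t) * \<phi> t)"
    by (simp add: algebra_simps sum.distrib)
  also have "(\<Sum>t\<in>UNIV. \<psi> (s * t)) = (\<Sum>t\<in>UNIV. \<psi> t)"
    by (rule sum.reindex_bij_witness[of _ "\<lambda>x. x / s" "\<lambda>x. s * x"]) (use assms in simp_all)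
  also have "\<dots> = 0" by (rule sum_psi)
  also have "(\<Sum>t\<in>UNIV. \<psi> (s * t) * \<phi> t) = - \<phi> s * g \<phi>"
    using gauss_twist[OF quad_char_in, of s] assms by simp
  finally show ?thesis by simp
qed

lemma quadratic_gauss_sum_linear:
  assumes "s \<noteq> 0"
  shows "(\<Sum>v\<in>UNIV. \<psi> (- s * v ^ 2 + z * v)) = - \<phi> (- s) * g \<phi> * \<psi> (z ^ 2 / (4 * s))"
proof -
  \<comment> \<open>Completing the square: \<open>- s * v ^ 2 + z * v\<close> equals
    \<open>- s * (v - c) ^ 2 + s * c ^ 2\<close>.\<close>
  define c where "c = z / (2 * s)"
  have z: "z = 2 * s * c" using assms two by (simp add: c_def)
  have sq: "z ^ 2 / (4 * s) = s * c ^ 2"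
    using assms four_nonzero unfolding z by (simp add: field_simps power2_eq_square)
  have "(\<Sum>v\<in>UNIV. \<psi> (- s * v ^ 2 + z * v)) = (\<Sum>u\<in>UNIV. \<psi> (- s * u ^ 2) * \<psi> (z ^ 2 / (4 * s)))"
  proof (rule sum.reindex_bij_witness[of _ "\<lambda>u. u + c" "\<lambda>v. v - c"])
    fix v
    have "- s * (v - c) ^ 2 + s * c ^ 2 = - s * v ^ 2 + z * v"
      unfolding z by (simp add: algebra_simps power2_eq_square)
    then show "\<psi> (- s * (v - c) ^ 2) * \<psi> (z ^ 2 / (4 * s)) = \<psi> (- s * v ^ 2 + z * v)"
      unfolding sq psi_add[symmetric] by simp
  qed simp_all
  also have "\<dots> = (\<Sum>u\<in>UNIV. \<psi> (- s * u ^ 2)) * \<psi> (z ^ 2 / (4 * s))"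
    by (simp only: sum_distrib_right)
  also have "(\<Sum>u\<in>UNIV. \<psi> (- s * u ^ 2)) = - \<phi> (- s) * g \<phi>"
    by (rule quadratic_gauss_sum) (use assms in simp)
  finally show ?thesis .
qed

text \<open>Expand the factor \<open>b (1 - v^2)\<close> as a Gauss sum over \<open>s\<close>; the sum over \<open>v\<close> becomes quadratic.\<close>
lemma salie_sum:
  assumes "b \<in> chars" "b \<noteq> \<epsilon>"
  shows "g (cinv b) * (\<Sum>v\<in>UNIV. b (1 - v ^ 2) * \<psi> (z * v)) =
    \<phi> (- 1 :: 'a) * g \<phi> * (\<Sum>s\<in>UNIV. (cinv b \<cdot> \<phi>) s * \<psi> (s + z ^ 2 / (4 * s)))"
proof -
  \<comment> \<open>Nontriviality of \<open>cinv b\<close> makes this hold also at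
    \<open>m = 0\<close>, so \<open>v = 1\<close> and \<open>v = - 1\<close> need no separate
    treatment.\<close>
  have b: "g (cinv b) * b m = (\<Sum>s\<in>UNIV. - (\<psi> (m * s) * cinv b s))" for m
    using gauss_twist[of "cinv b" m] assms by (simp add: cinv_eq_triv_iff sum_negf)
  have "g (cinv b) * (\<Sum>v\<in>UNIV. b (1 - v ^ 2) * \<psi> (z * v)) =
      (\<Sum>v\<in>UNIV. g (cinv b) * b (1 - v ^ 2) * \<psi> (z * v))"
    by (simp add: sum_distrib_left mult.assoc)
  also have "\<dots> = (\<Sum>v\<in>UNIV. \<Sum>s\<in>UNIV. - (cinv b s * \<psi> s * \<psi> (- s * v ^ 2 + z * v)))"
  proof (rule sum.cong)
    fix v
    have "\<psi> ((1 - v ^ 2) * s) * \<psi> (z * v) = \<psi> s * \<psi> (- s * v ^ 2 + z * v)" for s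
    proof -
      have "(1 - v ^ 2) * s + z * v = s + (- s * v ^ 2 + z * v)" by (simp add: algebra_simps)
      then show ?thesis by (metis psi_add)
    qed
    then show "g (cinv b) * b (1 - v ^ 2) * \<psi> (z * v) =
        (\<Sum>s\<in>UNIV. - (cinv b s * \<psi> s * \<psi> (- s * v ^ 2 + z * v)))"
      unfolding b sum_distrib_right by (intro sum.cong refl) (metis mult.assoc mult.commute mult_minus_left)
  qed simp
  also have "\<dots> = (\<Sum>s\<in>UNIV. - (cinv b s * \<psi> s * (\<Sum>v\<in>UNIV. \<psi> (- s * v ^ 2 + z * v))))"
    by (subst sum.swap) (simp only: sum_negf sum_distrib_left)
  also have "\<dots> = (\<Sum>s\<in>UNIV. \<phi> (- 1 :: 'a) * g \<phi> * ((cinv b \<cdot> \<phi>) s * \<psi> (s + z ^ 2 / (4 * s))))"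
  proof (rule sum.cong)
    fix s
    show "- (cinv b s * \<psi> s * (\<Sum>v\<in>UNIV. \<psi> (- s * v ^ 2 + z * v))) =
        \<phi> (- 1 :: 'a) * g \<phi> * ((cinv b \<cdot> \<phi>) s * \<psi> (s + z ^ 2 / (4 * s)))"
    \<comment> \<open>At \<open>s = 0\<close> the inner sum is no quadratic Gauss sum, but both
      sides contain a character evaluated at 0.\<close>
    proof (cases "s = 0")
      case True
      then show ?thesis by (simp add: cmul_apply quad_char_def)
        (simp add: cinv_apply chars_zero[OF assms(1)])
    next
      case False
      have "\<phi> (- s) = \<phi> (- 1 :: 'a) * (\<phi> s :: complex)"
        using chars_mult[OF quad_char_in, of "- 1" s] by simp
      then show ?thesis
        unfolding quadratic_gauss_sum_linear[OF False] psi_add[of s "z ^ 2 / (4 * s)"]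
        by (simp add: cmul_apply mult_ac)
    qed
  qed simp
  also have "\<dots> = \<phi> (- 1 :: 'a) * g \<phi> * (\<Sum>s\<in>UNIV. (cinv b \<cdot> \<phi>) s * \<psi> (s + z ^ 2 / (4 * s)))"
    by (simp only: sum_distrib_left)
  finally show ?thesis .
qed

section \<open>The Hasse-Davenport relation for the quadratic character\<close>

text \<open>The substitution \<open>u = (1 - v) / 2\<close> moves the centre of the symmetry between
  \<open>u\<close> and \<open>1 - u\<close> to 0, and
  \<open>4 * u * (1 - u) = 1 - v ^ 2\<close>.\<close>

lemma sum_symmetric_product:
  fixes b f :: "'a \<Rightarrow> complex"
  assumes "b \<in> chars"
  shows "(\<Sum>u\<in>UNIV. b u * b (1 - u) * f u) = (\<Sum>v\<in>UNIV. b (1 - v ^ 2) * f ((1 - v) / 2)) / b 4"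
proof -
  have "(\<Sum>u\<in>UNIV. b u * b (1 - u) * f u) = (\<Sum>v\<in>UNIV. b (1 - v ^ 2) / b 4 * f ((1 - v) / 2))"
  proof (rule sum.reindex_bij_witness[of _ "\<lambda>v. (1 - v) / 2" "\<lambda>u. 1 - 2 * u"])
    fix u :: 'a
    have "1 - (1 - 2 * u) ^ 2 = 4 * u * (1 - u)" by (simp add: algebra_simps power2_eq_square)
    then show "b (1 - (1 - 2 * u) ^ 2) / b 4 * f ((1 - (1 - 2 * u)) / 2) = b u * b (1 - u) * f u"
      using two chars_eq_0_iff[OF assms, of 4] four_nonzero by (simp add: chars_mult[OF assms])
  qed (use two in \<open>simp_all add: field_simps\<close>)
  then show ?thesis by (simp add: sum_divide_distrib)
qed

text \<open>The analogue of Legendre's duplication formula. The sum \<open>J\<close> is evaluated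
  twice: through \<open>sum_over_squares\<close> as the Jacobi sum of \<phi> and \<open>a\<close>,
  and through \<open>sum_symmetric_product\<close> as \<open>a 4\<close> times the Jacobi sum of
  \<open>a\<close> with itself.\<close>

lemma hasse_davenport:
  assumes "a \<in> chars"
  shows "g a * g (a \<cdot> \<phi>) * a 4 = g (a \<cdot> a) * g \<phi>"
proof -
  have 4: "(4 :: 'a) = 2 * 2" by simp
  \<comment> \<open>Outside the two characters of square \<epsilon>, all products that occur are
    nontrivial and \<open>g0\<close> agrees with \<open>g\<close>.\<close>
  consider "a = \<epsilon>" | "a = \<phi>" | "a \<noteq> \<epsilon>" "a \<cdot> a \<noteq> \<epsilon>" "a \<cdot> \<phi> \<noteq> \<epsilon>"
    using quad_char_order_two(3)[OF two assms] cmul_eq_triv_iff[of \<phi> a] assms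
    by (auto simp: cmul_commute)
  then show ?thesis
  proof cases
    case 1
    then show ?thesis using four_nonzero by (simp add: triv_char_def)
  next
    case 2
    have "\<phi> (2 :: 'a) * \<phi> (2 :: 'a) = (1 :: complex)"
      using two fun_cong[OF quad_quad, of 2] unfolding cmul_apply triv_char_def by simp
    then have "\<phi> (4 :: 'a) = (1 :: complex)"
      unfolding 4 chars_mult[OF quad_char_in] .
    with 2 show ?thesis by simp
  next
    case 3
    define J where "J = (\<Sum>v\<in>UNIV. a (1 - v ^ 2))"
    have "J = (\<Sum>s\<in>UNIV. (1 + \<phi> s) * a (1 - s))"
      unfolding J_def by (rule sum_over_squares[OF two])
    also have "\<dots> = (\<Sum>s\<in>UNIV. a (1 - s)) + (\<Sum>s\<in>UNIV. \<phi> s * a (1 - s))"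
      by (simp add: algebra_simps sum.distrib)
    also have "(\<Sum>s\<in>UNIV. a (1 - s)) = (\<Sum>s\<in>UNIV. a s)"
      by (rule sum.reindex_bij_witness[of _ "\<lambda>s. 1 - s" "\<lambda>s. 1 - s"]) simp_all
    also have "\<dots> = 0" by (rule sum_char_nontriv) fact+
    finally have J: "g \<phi> * g a = - g (a \<cdot> \<phi>) * J"
      using gauss_jacobi[of \<phi> a] assms 3 by (simp add: cmul_commute gauss0_nontriv)
    have "a 4 \<noteq> 0" using four_nonzero chars_eq_0_iff[OF assms] by simp
    then have "g a * g a * a 4 = - g (a \<cdot> a) * J"
      using gauss_jacobi[of a a] sum_symmetric_product[OF assms, of "\<lambda>_. 1"] assms 3
      by (simp add: J_def gauss0_nontriv)
    then have "(g a * g a * a 4) * g (a \<cdot> \<phi>) = g (a \<cdot> a) * (g \<phi> * g a)"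
      unfolding J by simp
    then have "g a * (g a * g (a \<cdot> \<phi>) * a 4) = g a * (g (a \<cdot> a) * g \<phi>)"
      by (simp only: mult_ac)
    then show ?thesis using gauss_nonzero[OF assms] by simp
  qed
qed

section \<open>Integral representations and Kummer's second formula\<close>

text \<open>Euler's integral: the quotient of the symbols of \<open>b\<close> and
  \<open>b \<cdot> b\<close> at \<nu> is a Jacobi sum up to a constant, and summing over \<nu> under
  the sum over \<open>u\<close> produces the exponential.\<close>

lemma hyp1F1_integral:
  assumes "b \<in> chars" "b \<noteq> \<epsilon>" "w \<noteq> 0"
  shows "hyp1F1 \<psi> b (b \<cdot> b) w =
    - (g0 (b \<cdot> b) / (g b) ^ 2) * (\<Sum>u\<in>UNIV. b u * b (1 - u) * \<psi> (- (u * w)))"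
proof -
  define C where "C = - g0 (b \<cdot> b) * q / (g b) ^ 2"
  have "hyp1F1 \<psi> b (b \<cdot> b) w =
      1 / (1 - q) * (\<Sum>\<nu>\<in>chars. \<Sum>u\<in>UNIV. C * (b u * b (1 - u)) * (\<nu> (u * w) / g0 \<nu>))"
    unfolding hyp1F1_def card_eq
  proof (rule arg_cong2[where f="(*)"], rule refl, rule sum.cong)
    fix \<nu> :: "'a \<Rightarrow> complex" assume \<nu>: "\<nu> \<in> chars"
    define J where "J = (\<Sum>u\<in>UNIV. (b \<cdot> \<nu>) u * b (1 - u))"
    \<comment> \<open>With the nontrivial \<open>b\<close> as second character, the Jacobi formula
      applies for every \<nu>.\<close>
    have "g (b \<cdot> \<nu>) * g b = - g0 (b \<cdot> b \<cdot> \<nu>) * J"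
      using gauss_jacobi[of "b \<cdot> \<nu>" b] assms \<nu> by (simp add: J_def cmul_ac)
    then have J: "g (b \<cdot> \<nu>) = - g0 (b \<cdot> b \<cdot> \<nu>) * J / g b"
      using gauss_nonzero[of b] assms by (simp add: field_simps)
    have "poch \<psi> b \<nu> / (poch0 \<psi> (b \<cdot> b) \<nu> * poch0 \<psi> \<epsilon> \<nu>) * \<nu> w = C * J * (\<nu> w / g0 \<nu>)"
      using gauss_nonzero[of "b \<cdot> b \<cdot> \<nu>"] gauss_nonzero[of "b \<cdot> b"] gauss_nonzero[of b]
        gauss_nonzero[OF \<nu>] assms \<nu> q_nonzero
      by (simp add: poch_def poch0_def J C_def gauss0_triv power2_eq_square mult_ac)
    also have "\<dots> = (\<Sum>u\<in>UNIV. C * (b u * b (1 - u)) * (\<nu> (u * w) / g0 \<nu>))"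
      unfolding J_def sum_distrib_left sum_distrib_right
      by (rule sum.cong) (simp_all add: cmul_apply chars_mult[OF \<nu>])
    finally show "poch \<psi> b \<nu> / (poch0 \<psi> (b \<cdot> b) \<nu> * poch0 \<psi> \<epsilon> \<nu>) * \<nu> w =
        (\<Sum>u\<in>UNIV. C * (b u * b (1 - u)) * (\<nu> (u * w) / g0 \<nu>))" .
  qed simp
  also have "\<dots> = 1 / (1 - q) *
      (\<Sum>u\<in>UNIV. C * (b u * b (1 - u)) * (\<Sum>\<nu>\<in>chars. \<nu> (u * w) / g0 \<nu>))"
    by (subst sum.swap) (simp only: sum_distrib_left)
  \<comment> \<open>At \<open>u = 0\<close> the character sum gives 0 and not an exponential, but
    \<open>b u\<close> vanishes there.\<close>
  also have "(\<Sum>u\<in>UNIV. C * (b u * b (1 - u)) * (\<Sum>\<nu>\<in>chars. \<nu> (u * w) / g0 \<nu>)) =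
      (\<Sum>u\<in>UNIV. C * (- (q - 1) / q) * (b u * b (1 - u) * \<psi> (- (u * w))))"
    by (rule sum.cong) (use assms(3) chars_zero[OF assms(1)] in \<open>simp_all add: sum_chars_div_gauss0\<close>)
  also have "\<dots> = C * (- (q - 1) / q) * (\<Sum>u\<in>UNIV. b u * b (1 - u) * \<psi> (- (u * w)))"
    by (simp only: sum_distrib_left)
  also have "1 / (1 - q) * \<dots> = C / q * (\<Sum>u\<in>UNIV. b u * b (1 - u) * \<psi> (- (u * w)))"
    using q_nonzero by (simp add: divide_simps)
  finally show ?thesis using q_nonzero by (simp add: C_def)
qed

text \<open>The factor \<open>1 / g0 (c \<cdot> \<nu>)\<close> is expanded as a Gauss sum over
  \<open>x\<close>; the remaining sum over \<nu> is the exponential series at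
  \<open>- w / x\<close>.\<close>

lemma hyp0F1_integral:
  assumes "c \<in> chars" "w \<noteq> 0"
  shows "hyp0F1 \<psi> c w = - (1 / g (cinv c)) * (\<Sum>x\<in>UNIV. cinv c x * \<psi> (x + w / x))"
proof -
  define C where "C = - g0 c * c (- 1)"
  have "hyp0F1 \<psi> c w =
      1 / (1 - q) * (\<Sum>\<nu>\<in>chars. \<Sum>x\<in>UNIV. C * (\<psi> x * cinv c x) * (\<nu> (- w / x) / g0 \<nu>))"
    unfolding hyp0F1_def card_eq
  proof (rule arg_cong2[where f="(*)"], rule refl, rule sum.cong)
    fix \<nu> :: "'a \<Rightarrow> complex" assume \<nu>: "\<nu> \<in> chars"
    have "\<nu> w / (poch0 \<psi> c \<nu> * poch0 \<psi> \<epsilon> \<nu>) = \<nu> w * (g0 c * q * (1 / g0 (c \<cdot> \<nu>))) / g0 \<nu>"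
      using \<nu> by (simp add: poch0_def gauss0_triv)
    also have "1 / g0 (c \<cdot> \<nu>) = g (cinv c \<cdot> cinv \<nu>) * (c (- 1) * \<nu> (- 1)) / q"
      using inverse_gauss0[of "c \<cdot> \<nu>"] assms \<nu> by (simp add: cinv_cmul cmul_apply)
    also have "g (cinv c \<cdot> cinv \<nu>) = - (\<Sum>x\<in>UNIV. \<psi> x * (cinv c x * inverse (\<nu> x)))"
      using gauss_eq[of "cinv c \<cdot> cinv \<nu>"] assms \<nu>
      by (simp add: cmul_apply) (simp add: cinv_apply)
    also have "\<nu> w * (g0 c * q * (- (\<Sum>x\<in>UNIV. \<psi> x * (cinv c x * inverse (\<nu> x))) * (c (- 1) * \<nu> (- 1)) / q)) / g0 \<nu> =
        (\<Sum>x\<in>UNIV. \<psi> x * (cinv c x * inverse (\<nu> x))) * (C * (\<nu> (- 1) * \<nu> w) / g0 \<nu>)"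
      using q_nonzero by (simp add: C_def)
    also have "\<dots> = (\<Sum>x\<in>UNIV. C * (\<psi> x * cinv c x) * (\<nu> (- w / x) / g0 \<nu>))"
      unfolding sum_distrib_right
    proof (rule sum.cong)
      fix x
      have "- w / x = - 1 * w * inverse x" by (simp add: divide_inverse)
      then have "\<nu> (- w / x) = \<nu> (- 1) * \<nu> w * inverse (\<nu> x)"
        by (simp only: chars_mult[OF \<nu>] chars_inverse[OF \<nu>])
      then show "\<psi> x * (cinv c x * inverse (\<nu> x)) * (C * (\<nu> (- 1) * \<nu> w) / g0 \<nu>) =
          C * (\<psi> x * cinv c x) * (\<nu> (- w / x) / g0 \<nu>)" by simp
    qed simp
    finally show "\<nu> w / (poch0 \<psi> c \<nu> * poch0 \<psi> \<epsilon> \<nu>) =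
        (\<Sum>x\<in>UNIV. C * (\<psi> x * cinv c x) * (\<nu> (- w / x) / g0 \<nu>))" .
  qed simp
  also have "\<dots> = 1 / (1 - q) *
      (\<Sum>x\<in>UNIV. C * (\<psi> x * cinv c x) * (\<Sum>\<nu>\<in>chars. \<nu> (- w / x) / g0 \<nu>))"
    by (subst sum.swap) (simp only: sum_distrib_left)
  also have "(\<Sum>x\<in>UNIV. C * (\<psi> x * cinv c x) * (\<Sum>\<nu>\<in>chars. \<nu> (- w / x) / g0 \<nu>)) =
      (\<Sum>x\<in>UNIV. C * (- (q - 1) / q) * (cinv c x * \<psi> (x + w / x)))"
  proof (rule sum.cong)
    fix x :: 'a
    have "- (- w / x) = w / x" by simp
    then show "C * (\<psi> x * cinv c x) * (\<Sum>\<nu>\<in>chars. \<nu> (- w / x) / g0 \<nu>) =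
        C * (- (q - 1) / q) * (cinv c x * \<psi> (x + w / x))"
      using assms(2) chars_zero[OF cinv_in[OF assms(1)]] unfolding sum_chars_div_gauss0 psi_add
      by (cases "x = 0") simp_all
  qed simp
  also have "\<dots> = C * (- (q - 1) / q) * (\<Sum>x\<in>UNIV. cinv c x * \<psi> (x + w / x))"
    by (simp only: sum_distrib_left)
  also have "1 / (1 - q) * \<dots> = C / q * (\<Sum>x\<in>UNIV. cinv c x * \<psi> (x + w / x))"
    using q_nonzero by (simp add: divide_simps)
  also have "C / q = - (1 / g (cinv c))"
    using inverse_gauss0[OF assms(1)] chars_minus_sq[OF assms(1)] q_nonzero
      gauss_nonzero(2)[OF assms(1)] gauss_nonzero(1)[OF cinv_in[OF assms(1)]]
    by (simp add: C_def field_simps)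
  finally show ?thesis .
qed

text \<open>The finite field analogue of Kummer's second formula
  \<open>1F1(b; 2b; 2z) = exp z \<cdot> 0F1(b + 1/2; z^2/4)\<close>.\<close>
lemma kummer_second:
  assumes "b \<in> chars" "b \<noteq> \<epsilon>" "z \<noteq> 0"
  shows "hyp1F1 \<psi> b (b \<cdot> b) (2 * z) = \<psi> (- z) * hyp0F1 \<psi> (b \<cdot> \<phi>) (z ^ 2 / 4)"
proof -
  define S where "S = (\<Sum>v\<in>UNIV. b (1 - v ^ 2) * \<psi> (z * v))"
  define K where "K = (\<Sum>s\<in>UNIV. (cinv b \<cdot> \<phi>) s * \<psi> (s + z ^ 2 / (4 * s)))"
  have ne: "g b \<noteq> 0" "g (cinv b) \<noteq> 0" "g (cinv b \<cdot> \<phi>) \<noteq> 0" "g \<phi> \<noteq> 0"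
    using assms by (simp_all add: gauss_nonzero)
  have b4: "b 4 \<noteq> 0" using four_nonzero chars_eq_0_iff[OF assms(1)] by simp
  have p1: "\<phi> (- 1 :: 'a) * \<phi> (- 1 :: 'a) = (1 :: complex)"
    by (rule chars_minus_sq) simp
  \<comment> \<open>Centring the integral splits the phase into \<open>- z\<close> and
    \<open>z * v\<close>: the first gives the additive character of the claim, the second the sum of
    \<open>salie_sum\<close>.\<close>
  have "(\<Sum>u\<in>UNIV. b u * b (1 - u) * \<psi> (- (u * (2 * z)))) =
      (\<Sum>v\<in>UNIV. b (1 - v ^ 2) * \<psi> (- ((1 - v) / 2 * (2 * z)))) / b 4"
    by (rule sum_symmetric_product[OF assms(1)])
  also have "(\<Sum>v\<in>UNIV. b (1 - v ^ 2) * \<psi> (- ((1 - v) / 2 * (2 * z)))) = \<psi> (- z) * S"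
    unfolding S_def sum_distrib_left
  proof (rule sum.cong)
    fix v :: 'a
    have "- ((1 - v) / 2 * (2 * z)) = - z + z * v" using two by (simp add: field_simps)
    then show "b (1 - v ^ 2) * \<psi> (- ((1 - v) / 2 * (2 * z))) = \<psi> (- z) * (b (1 - v ^ 2) * \<psi> (z * v))"
      by (simp only: psi_add mult_ac)
  qed simp
  finally have 1: "hyp1F1 \<psi> b (b \<cdot> b) (2 * z) = - (g0 (b \<cdot> b) / (g b) ^ 2) * (\<psi> (- z) * S / b 4)"
    using hyp1F1_integral[of b "2 * z"] assms two by simp
  have 2: "hyp0F1 \<psi> (b \<cdot> \<phi>) (z ^ 2 / 4) = - (1 / g (cinv b \<cdot> \<phi>)) * K"
    using hyp0F1_integral[of "b \<cdot> \<phi>" "z ^ 2 / 4"] assms four_nonzero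
    by (simp add: cinv_cmul K_def)
  have 3: "g (cinv b) * S = \<phi> (- 1 :: 'a) * g \<phi> * K"
    unfolding S_def K_def by (rule salie_sum) fact+
  have hd: "g (cinv b) * g (cinv b \<cdot> \<phi>) = b 4 * (g (cinv (b \<cdot> b)) * g \<phi>)"
    using hasse_davenport[of "cinv b"] assms b4 by (simp add: cinv_cmul cinv_apply field_simps)
  \<comment> \<open>Keeping \<open>g0\<close> here includes the case where
    \<open>b \<cdot> b\<close> is trivial, that is, \<open>b = \<phi>\<close>.\<close>
  have r1: "g (cinv (b \<cdot> b)) * g0 (b \<cdot> b) = q"
    using gauss_reflect[of "cinv (b \<cdot> b)"] assms chars_minus_sq[OF assms(1)]
    by (simp add: cinv_apply cmul_apply)
  have r2: "g b * g (cinv b) = q * b (- 1)"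
    using gauss_reflect[of b] assms by (simp add: gauss0_nontriv cinv_eq_triv_iff)
  have r3: "g \<phi> * g \<phi> = q * \<phi> (- 1 :: 'a)"
    using gauss_reflect[of \<phi>] quad_char_nontriv by (simp add: gauss0_nontriv)
  have bb: "b (- 1) * b (- 1) = 1" by (rule chars_minus_sq[OF assms(1)])
  \<comment> \<open>Matching of constants: \<open>hd\<close> together with the reflections
    \<open>r1\<close> and \<open>r3\<close> gives \<open>q ^ 2 * b 4\<close>, and so does the target
    side by \<open>r2\<close>; all signs at \<open>- 1\<close> occur squared.\<close>
  have "g (cinv b) * (g0 (b \<cdot> b) * g (cinv b \<cdot> \<phi>) * \<phi> (- 1 :: 'a) * g \<phi>) =
      \<phi> (- 1 :: 'a) * (g \<phi> * g \<phi>) * b 4 * (g (cinv (b \<cdot> b)) * g0 (b \<cdot> b))"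
    using arg_cong[OF hd, of "\<lambda>t. t * (g0 (b \<cdot> b) * \<phi> (- 1 :: 'a) * g \<phi>)"]
    by (simp only: mult_ac)
  also have "\<dots> = q ^ 2 * b 4 * (\<phi> (- 1 :: 'a) * \<phi> (- 1 :: 'a))"
    unfolding r1 r3 by (simp add: power2_eq_square)
  also have "\<dots> = (g b * g (cinv b)) ^ 2 * b 4"
    unfolding r2 p1 using bb by (simp add: power2_eq_square)
  finally have key: "g0 (b \<cdot> b) * g (cinv b \<cdot> \<phi>) * \<phi> (- 1 :: 'a) * g \<phi> = (g b) ^ 2 * g (cinv b) * b 4"
    using ne by (simp add: power2_eq_square mult_ac)
  have S: "S = \<phi> (- 1 :: 'a) * g \<phi> * K / g (cinv b)"
    using 3 ne by (simp add: field_simps)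
  have "g0 (b \<cdot> b) * S * g (cinv b \<cdot> \<phi>) =
      (g0 (b \<cdot> b) * g (cinv b \<cdot> \<phi>) * \<phi> (- 1 :: 'a) * g \<phi>) * K / g (cinv b)"
    unfolding S by simp
  also have "\<dots> = (g b) ^ 2 * b 4 * K"
    unfolding key using ne by simp
  finally have "g0 (b \<cdot> b) * S * g (cinv b \<cdot> \<phi>) = (g b) ^ 2 * b 4 * K" .
  then have "g0 (b \<cdot> b) / (g b) ^ 2 * (S / b 4) = 1 / g (cinv b \<cdot> \<phi>) * K"
    using ne b4 by (simp add: field_simps)
  from arg_cong[OF this, of "\<lambda>t. - \<psi> (- z) * t"] show ?thesis
    unfolding 1 2 by (simp add: mult_ac)
qed

section \<open>Mellin transforms and the reduction of \<open>F2\<close> to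
  \<open>2F1\<close>\<close>

text \<open>The analogue of the Weber-Schafheitlin integral. After expanding both series, the sum
  over \<open>s\<close> leaves only \<mu> inverse to \<open>\<alpha> \<cdot> \<nu>\<close>;
  reflecting the two denominators in \<mu> yields the numerator parameters \<alpha> and
  \<open>\<alpha> \<cdot> cinv \<gamma>2\<close>.\<close>

lemma sum_hyp0F1_product:
  assumes "\<alpha> \<in> chars" "\<gamma>1 \<in> chars" "\<gamma>2 \<in> chars" "A \<noteq> 0" "B \<noteq> 0"
  shows "(\<Sum>s\<in>UNIV. \<alpha> s * (hyp0F1 \<psi> \<gamma>1 (A * s) * hyp0F1 \<psi> \<gamma>2 (B * s))) =
    - cinv \<alpha> B * g \<alpha> * poch \<psi> (cinv \<gamma>2) \<alpha> * hyp2F1 \<psi> \<alpha> (\<alpha> \<cdot> cinv \<gamma>2) \<gamma>1 (A / B)"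
proof -
  define D where "D \<gamma> \<nu> = poch0 \<psi> \<gamma> \<nu> * poch0 \<psi> \<epsilon> \<nu>" for \<gamma> \<nu>
  define c where "c = 1 / (1 - q)"
  define T where "T \<nu> \<mu> = c ^ 2 * (\<nu> A / D \<gamma>1 \<nu> * (\<mu> B / D \<gamma>2 \<mu>))" for \<nu> \<mu>
  \<comment> \<open>Orthogonality contributes \<open>q - 1\<close>, which reduces the prefactors of
    two series to the single one of \<open>hyp2F1\<close>.\<close>
  have cq: "c ^ 2 * (q - 1) = - c"
  proof -
    have "c * (1 - q) = 1" using q_nonzero by (simp add: c_def)
    moreover have "c ^ 2 * (q - 1) = - (c * (c * (1 - q)))"
      by (simp add: power2_eq_square algebra_simps)
    ultimately show ?thesis by (simp only: mult_1_right)
  qed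
  have summand: "(q - 1) * T \<nu> (cinv (\<alpha> \<cdot> \<nu>)) = - cinv \<alpha> B * g \<alpha> * poch \<psi> (cinv \<gamma>2) \<alpha> *
      (c * (poch \<psi> \<alpha> \<nu> * poch \<psi> (\<alpha> \<cdot> cinv \<gamma>2) \<nu> / (poch0 \<psi> \<epsilon> \<nu> * poch0 \<psi> \<gamma>1 \<nu>) * \<nu> (A / B)))"
    if \<nu>: "\<nu> \<in> chars" for \<nu>
  proof -
    define \<kappa> where "\<kappa> = \<alpha> \<cdot> \<nu>"
    have \<kappa>: "\<kappa> \<in> chars" using \<nu> assms by (simp add: \<kappa>_def)
    have "1 / D \<gamma>2 (cinv \<kappa>) = (1 / poch0 \<psi> \<gamma>2 (cinv \<kappa>)) * (1 / poch0 \<psi> \<epsilon> (cinv \<kappa>))"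
      by (simp add: D_def)
    also have "\<dots> = (\<kappa> (- 1) * \<kappa> (- 1)) * (poch \<psi> (cinv \<gamma>2) \<kappa> * poch \<psi> \<epsilon> \<kappa>)"
      using poch0_reflect[OF assms(3) \<kappa>] poch0_reflect[OF triv_char_in \<kappa>] by simp
    also have "\<kappa> (- 1) * \<kappa> (- 1) = 1" by (rule chars_minus_sq[OF \<kappa>])
    also have "poch \<psi> \<epsilon> \<kappa> = g \<alpha> * poch \<psi> \<alpha> \<nu>"
      using gauss_nonzero[OF assms(1)] \<kappa> by (simp add: poch_def gauss_triv \<kappa>_def)
    also have "poch \<psi> (cinv \<gamma>2) \<kappa> = poch \<psi> (cinv \<gamma>2) \<alpha> * poch \<psi> (\<alpha> \<cdot> cinv \<gamma>2) \<nu>"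
      using gauss_nonzero[of "\<alpha> \<cdot> cinv \<gamma>2"] assms by (simp add: poch_def \<kappa>_def cmul_ac)
    finally have D2: "1 / D \<gamma>2 (cinv \<kappa>) =
        poch \<psi> (cinv \<gamma>2) \<alpha> * poch \<psi> (\<alpha> \<cdot> cinv \<gamma>2) \<nu> * (g \<alpha> * poch \<psi> \<alpha> \<nu>)" by simp
    have "(q - 1) * T \<nu> (cinv \<kappa>) = (c ^ 2 * (q - 1)) * (\<nu> A / D \<gamma>1 \<nu> * (cinv \<kappa> B * (1 / D \<gamma>2 (cinv \<kappa>))))"
      by (simp add: T_def)
    also have "cinv \<kappa> B = cinv \<alpha> B * inverse (\<nu> B)"
      by (simp add: \<kappa>_def cmul_apply cinv_apply)
    finally show ?thesis
      unfolding cq D2 \<kappa>_def[symmetric] chars_divide[OF \<nu>] by (simp add: D_def divide_inverse mult_ac)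
  qed
  have "(\<Sum>s\<in>UNIV. \<alpha> s * (hyp0F1 \<psi> \<gamma>1 (A * s) * hyp0F1 \<psi> \<gamma>2 (B * s))) =
      (\<Sum>s\<in>UNIV. \<Sum>\<nu>\<in>chars. \<Sum>\<mu>\<in>chars. T \<nu> \<mu> * (\<alpha> \<cdot> \<nu> \<cdot> \<mu>) s)"
  proof (rule sum.cong)
    fix s
    have "\<alpha> s * (hyp0F1 \<psi> \<gamma>1 (A * s) * hyp0F1 \<psi> \<gamma>2 (B * s)) =
        \<alpha> s * c ^ 2 * ((\<Sum>\<nu>\<in>chars. \<nu> (A * s) / D \<gamma>1 \<nu>) * (\<Sum>\<mu>\<in>chars. \<mu> (B * s) / D \<gamma>2 \<mu>))"
      by (simp add: hyp0F1_def D_def c_def power2_eq_square)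
    also have "\<dots> = (\<Sum>\<nu>\<in>chars. \<Sum>\<mu>\<in>chars. \<alpha> s * c ^ 2 * (\<nu> (A * s) / D \<gamma>1 \<nu> * (\<mu> (B * s) / D \<gamma>2 \<mu>)))"
      by (simp only: sum_product) (simp only: sum_distrib_left)
    also have "\<dots> = (\<Sum>\<nu>\<in>chars. \<Sum>\<mu>\<in>chars. T \<nu> \<mu> * (\<alpha> \<cdot> \<nu> \<cdot> \<mu>) s)"
      by (intro sum.cong refl) (simp add: T_def cmul_apply chars_mult)
    finally show "\<alpha> s * (hyp0F1 \<psi> \<gamma>1 (A * s) * hyp0F1 \<psi> \<gamma>2 (B * s)) =
        (\<Sum>\<nu>\<in>chars. \<Sum>\<mu>\<in>chars. T \<nu> \<mu> * (\<alpha> \<cdot> \<nu> \<cdot> \<mu>) s)" .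
  qed simp
  also have "\<dots> = (\<Sum>\<nu>\<in>chars. \<Sum>s\<in>UNIV. \<Sum>\<mu>\<in>chars. T \<nu> \<mu> * (\<alpha> \<cdot> \<nu> \<cdot> \<mu>) s)"
    by (rule sum.swap)
  also have "\<dots> = (\<Sum>\<nu>\<in>chars. \<Sum>\<mu>\<in>chars. \<Sum>s\<in>UNIV. T \<nu> \<mu> * (\<alpha> \<cdot> \<nu> \<cdot> \<mu>) s)"
    by (rule sum.cong[OF refl], rule sum.swap)
  also have "\<dots> = (\<Sum>\<nu>\<in>chars. \<Sum>\<mu>\<in>chars. if \<mu> = cinv (\<alpha> \<cdot> \<nu>) then (q - 1) * T \<nu> \<mu> else 0)"
  proof (intro sum.cong refl)
    fix \<nu> \<mu> :: "'a \<Rightarrow> complex" assume \<nu>: "\<nu> \<in> chars" and \<mu>: "\<mu> \<in> chars"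
    have in_chars: "\<alpha> \<cdot> \<nu> \<in> chars" using assms \<nu> by simp
    have "(\<Sum>s\<in>UNIV. (\<alpha> \<cdot> \<nu> \<cdot> \<mu>) s) = (if \<mu> = cinv (\<alpha> \<cdot> \<nu>) then q - 1 else 0)"
      using cmul_eq_triv_iff[OF in_chars \<mu>] sum_char_nontriv[OF cmul_in[OF in_chars \<mu>]]
        sum_triv_char[where ?'a='a]
      by (cases "\<mu> = cinv (\<alpha> \<cdot> \<nu>)") simp_all
    then show "(\<Sum>s\<in>UNIV. T \<nu> \<mu> * (\<alpha> \<cdot> \<nu> \<cdot> \<mu>) s) =
        (if \<mu> = cinv (\<alpha> \<cdot> \<nu>) then (q - 1) * T \<nu> \<mu> else 0)"
      unfolding sum_distrib_left[symmetric] by simp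
  qed
  also have "\<dots> = (\<Sum>\<nu>\<in>chars. (q - 1) * T \<nu> (cinv (\<alpha> \<cdot> \<nu>)))"
  proof (rule sum.cong)
    fix \<nu> :: "'a \<Rightarrow> complex" assume "\<nu> \<in> chars"
    then have "cinv (\<alpha> \<cdot> \<nu>) \<in> chars" using assms by simp
    then show "(\<Sum>\<mu>\<in>chars. if \<mu> = cinv (\<alpha> \<cdot> \<nu>) then (q - 1) * T \<nu> \<mu> else 0) =
        (q - 1) * T \<nu> (cinv (\<alpha> \<cdot> \<nu>))"
      by (simp add: sum.delta)
  qed simp
  also have "\<dots> = - cinv \<alpha> B * g \<alpha> * poch \<psi> (cinv \<gamma>2) \<alpha> * hyp2F1 \<psi> \<alpha> (\<alpha> \<cdot> cinv \<gamma>2) \<gamma>1 (A / B)"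
    unfolding hyp2F1_def sum_distrib_left card_eq c_def[symmetric] by (rule sum.cong) (simp_all only: summand)
  finally show ?thesis .
qed

lemma appellF2_integral:
  assumes "\<alpha> \<in> chars"
  shows "appellF2 \<psi> \<alpha> \<beta>1 \<beta>2 \<gamma>1 \<gamma>2 x y =
    - (1 / g \<alpha>) * (\<Sum>t\<in>UNIV. \<psi> t * \<alpha> t * (hyp1F1 \<psi> \<beta>1 \<gamma>1 (x * t) * hyp1F1 \<psi> \<beta>2 \<gamma>2 (y * t)))"
proof -
  define P where "P \<beta> \<gamma> \<nu> = poch \<psi> \<beta> \<nu> / (poch0 \<psi> \<gamma> \<nu> * poch0 \<psi> \<epsilon> \<nu>)" for \<beta> \<gamma> \<nu>
  define c where "c = 1 / (1 - q)"
  let ?h = "\<lambda>t. hyp1F1 \<psi> \<beta>1 \<gamma>1 (x * t) * hyp1F1 \<psi> \<beta>2 \<gamma>2 (y * t)"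
  have h: "?h t = (\<Sum>\<nu>\<in>chars. \<Sum>\<mu>\<in>chars. c ^ 2 * (P \<beta>1 \<gamma>1 \<nu> * \<nu> (x * t) * (P \<beta>2 \<gamma>2 \<mu> * \<mu> (y * t))))" for t
  proof -
    have "?h t = c ^ 2 * ((\<Sum>\<nu>\<in>chars. P \<beta>1 \<gamma>1 \<nu> * \<nu> (x * t)) * (\<Sum>\<mu>\<in>chars. P \<beta>2 \<gamma>2 \<mu> * \<mu> (y * t)))"
      by (simp add: hyp1F1_def P_def c_def power2_eq_square)
    then show ?thesis by (simp only: sum_product) (simp only: sum_distrib_left)
  qed
  have "- (1 / g \<alpha>) * (\<Sum>t\<in>UNIV. \<psi> t * \<alpha> t * ?h t) =
      (\<Sum>t\<in>UNIV. \<Sum>\<nu>\<in>chars. \<Sum>\<mu>\<in>chars. - (1 / g \<alpha>) * (\<psi> t * \<alpha> t *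
        (c ^ 2 * (P \<beta>1 \<gamma>1 \<nu> * \<nu> (x * t) * (P \<beta>2 \<gamma>2 \<mu> * \<mu> (y * t))))))"
    unfolding h by (simp only: sum_distrib_left)
  also have "\<dots> = (\<Sum>\<nu>\<in>chars. \<Sum>t\<in>UNIV. \<Sum>\<mu>\<in>chars. - (1 / g \<alpha>) * (\<psi> t * \<alpha> t *
        (c ^ 2 * (P \<beta>1 \<gamma>1 \<nu> * \<nu> (x * t) * (P \<beta>2 \<gamma>2 \<mu> * \<mu> (y * t))))))"
    by (rule sum.swap)
  also have "\<dots> = (\<Sum>\<nu>\<in>chars. \<Sum>\<mu>\<in>chars. \<Sum>t\<in>UNIV. - (1 / g \<alpha>) * (\<psi> t * \<alpha> t *
        (c ^ 2 * (P \<beta>1 \<gamma>1 \<nu> * \<nu> (x * t) * (P \<beta>2 \<gamma>2 \<mu> * \<mu> (y * t))))))"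
    by (rule sum.cong[OF refl], rule sum.swap)
  also have "\<dots> = (\<Sum>\<nu>\<in>chars. \<Sum>\<mu>\<in>chars. c ^ 2 * (poch \<psi> \<alpha> (\<nu> \<cdot> \<mu>) *
      (P \<beta>1 \<gamma>1 \<nu> * P \<beta>2 \<gamma>2 \<mu> * \<nu> x * \<mu> y)))"
  proof (intro sum.cong refl)
    fix \<nu> \<mu> :: "'a \<Rightarrow> complex" assume \<nu>: "\<nu> \<in> chars" and \<mu>: "\<mu> \<in> chars"
    have "(\<Sum>t\<in>UNIV. - (1 / g \<alpha>) * (\<psi> t * \<alpha> t *
        (c ^ 2 * (P \<beta>1 \<gamma>1 \<nu> * \<nu> (x * t) * (P \<beta>2 \<gamma>2 \<mu> * \<mu> (y * t)))))) =
      (\<Sum>t\<in>UNIV. - (1 / g \<alpha>) * (c ^ 2 * (P \<beta>1 \<gamma>1 \<nu> * P \<beta>2 \<gamma>2 \<mu> * \<nu> x * \<mu> y)) *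
        (\<psi> t * (\<alpha> \<cdot> (\<nu> \<cdot> \<mu>)) t))"
      by (intro sum.cong refl) (simp add: cmul_apply chars_mult[OF \<nu>] chars_mult[OF \<mu>] mult_ac)
    also have "\<dots> = - (1 / g \<alpha>) * (c ^ 2 * (P \<beta>1 \<gamma>1 \<nu> * P \<beta>2 \<gamma>2 \<mu> * \<nu> x * \<mu> y)) *
        - g (\<alpha> \<cdot> (\<nu> \<cdot> \<mu>))"
      unfolding sum_distrib_left[symmetric] using gauss_eq[of "\<alpha> \<cdot> (\<nu> \<cdot> \<mu>)"] assms \<nu> \<mu> by simp
    finally show "(\<Sum>t\<in>UNIV. - (1 / g \<alpha>) * (\<psi> t * \<alpha> t *
        (c ^ 2 * (P \<beta>1 \<gamma>1 \<nu> * \<nu> (x * t) * (P \<beta>2 \<gamma>2 \<mu> * \<mu> (y * t)))))) =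
      c ^ 2 * (poch \<psi> \<alpha> (\<nu> \<cdot> \<mu>) * (P \<beta>1 \<gamma>1 \<nu> * P \<beta>2 \<gamma>2 \<mu> * \<nu> x * \<mu> y))"
      by (simp add: poch_def)
  qed
  also have "\<dots> = appellF2 \<psi> \<alpha> \<beta>1 \<beta>2 \<gamma>1 \<gamma>2 x y"
    unfolding appellF2_def card_eq sum_distrib_left
    by (intro sum.cong refl) (simp add: P_def c_def power_one_over mult_ac)
  finally show ?thesis ..
qed

text \<open>The relation \<open>x + y = 2\<close> is what makes the additive characters from
  Kummer's formula cancel against \<open>\<psi> t\<close>; that formula also requires nonzero
  arguments.\<close>

lemma appellF2_square_parameters:
  assumes \<alpha>: "\<alpha> \<in> chars" and \<beta>: "\<beta>1 \<in> chars" "\<beta>2 \<in> chars" "\<beta>1 \<noteq> \<epsilon>" "\<beta>2 \<noteq> \<epsilon>"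
    and xy: "x \<noteq> 0" "y \<noteq> 0" "x + y = 2"
  shows "appellF2 \<psi> (\<alpha> \<cdot> \<alpha>) \<beta>1 \<beta>2 (\<beta>1 \<cdot> \<beta>1) (\<beta>2 \<cdot> \<beta>2) x y =
    (cinv \<alpha> \<cdot> cinv \<alpha>) (y / 2) *
    (\<Sum>\<alpha>'\<in>{\<alpha>, \<alpha> \<cdot> \<phi>}. poch \<psi> (cinv \<beta>2 \<cdot> \<phi>) \<alpha>' / poch \<psi> \<phi> \<alpha>' *
       hyp2F1 \<psi> \<alpha>' (\<alpha>' \<cdot> cinv \<beta>2 \<cdot> \<phi>) (\<beta>1 \<cdot> \<phi>) ((x / y) ^ 2))"
proof -
  \<comment> \<open>Kummer's formula at \<open>w * t\<close> has the \<open>0F1\<close> argument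
    \<open>(w * t / 2) ^ 2 / 4\<close>, which is \<open>(w / 4) ^ 2 * t ^ 2\<close>.\<close>
  define A B where "A = (x / 4) ^ 2" and "B = (y / 4) ^ 2"
  define F where "F s = hyp0F1 \<psi> (\<beta>1 \<cdot> \<phi>) (A * s) * hyp0F1 \<psi> (\<beta>2 \<cdot> \<phi>) (B * s)" for s
  have four: "(4 :: 'a) = 2 * 2" by simp
  have "x / 4 \<noteq> 0" "y / 4 \<noteq> 0" "x / 4 / (y / 4) = x / y"
    using xy four_nonzero by simp_all
  then have AB: "A \<noteq> 0" "B \<noteq> 0" "A / B = (x / y) ^ 2"
    unfolding A_def B_def by (metis power_not_zero, metis power_not_zero, metis power_divide)
  have kummer: "hyp1F1 \<psi> \<beta> (\<beta> \<cdot> \<beta>) (w * t) = \<psi> (- (w * t / 2)) * hyp0F1 \<psi> (\<beta> \<cdot> \<phi>) ((w / 4) ^ 2 * t ^ 2)"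
    if "\<beta> \<in> chars" "\<beta> \<noteq> \<epsilon>" "w \<noteq> 0" "t \<noteq> 0" for \<beta> w t
  proof -
    have 1: "(w * t / 2) ^ 2 / 4 = (w / 4) ^ 2 * t ^ 2"
      unfolding four
      by (simp only: power2_eq_square times_divide_times_eq divide_divide_eq_left mult_ac
          times_divide_eq_left times_divide_eq_right)
    have 2: "2 * (w * t / 2) = w * t" using two by simp
    have "w * t / 2 \<noteq> 0" using that two by simp
    from kummer_second[OF that(1,2) this] show ?thesis
      unfolding 1 2 .
  qed
  have "(\<Sum>t\<in>UNIV. \<psi> t * (\<alpha> \<cdot> \<alpha>) t *
        (hyp1F1 \<psi> \<beta>1 (\<beta>1 \<cdot> \<beta>1) (x * t) * hyp1F1 \<psi> \<beta>2 (\<beta>2 \<cdot> \<beta>2) (y * t))) =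
      (\<Sum>t\<in>UNIV. \<alpha> (t ^ 2) * F (t ^ 2))"
  proof (intro sum.cong refl)
    fix t
    show "\<psi> t * (\<alpha> \<cdot> \<alpha>) t *
        (hyp1F1 \<psi> \<beta>1 (\<beta>1 \<cdot> \<beta>1) (x * t) * hyp1F1 \<psi> \<beta>2 (\<beta>2 \<cdot> \<beta>2) (y * t)) = \<alpha> (t ^ 2) * F (t ^ 2)"
    proof (cases "t = 0")
      case True
      then show ?thesis by (simp add: cmul_apply chars_zero[OF \<alpha>])
    next
      case False
      have "x * t / 2 + y * t / 2 = (x + y) * t / 2"
        by (simp add: add_divide_distrib distrib_right)
      then have "t + (- (x * t / 2) + - (y * t / 2)) = 0"
        using two xy(3) by (simp add: algebra_simps)
      then have "\<psi> t * (\<psi> (- (x * t / 2)) * \<psi> (- (y * t / 2))) = 1"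
        using psi_0 by (metis psi_add)
      then show ?thesis
        unfolding kummer[OF \<beta>(1,3) xy(1) False] kummer[OF \<beta>(2,4) xy(2) False]
        by (simp add: F_def A_def B_def power2_eq_square[of t] chars_mult[OF \<alpha>] cmul_apply)
    qed
  qed
  also have "\<dots> = (\<Sum>s\<in>UNIV. (1 + \<phi> s) * (\<alpha> s * F s))"
    by (rule sum_over_squares[OF two])
  also have "\<dots> = (\<Sum>s\<in>UNIV. \<alpha> s * F s) + (\<Sum>s\<in>UNIV. (\<alpha> \<cdot> \<phi>) s * F s)"
    by (simp add: cmul_apply algebra_simps sum.distrib)
  also have "\<dots> = (\<Sum>\<alpha>'\<in>{\<alpha>, \<alpha> \<cdot> \<phi>}. \<Sum>s\<in>UNIV. \<alpha>' s * F s)"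
  proof -
    \<comment> \<open>A sum over the set has two terms only if its two elements differ.\<close>
    have "\<alpha> \<noteq> \<alpha> \<cdot> \<phi>"
      using quad_char_nontriv \<alpha> by (metis cmul_cancel(1) cmul_cinv(2) quad_char_in)
    then show ?thesis by simp
  qed
  finally have "appellF2 \<psi> (\<alpha> \<cdot> \<alpha>) \<beta>1 \<beta>2 (\<beta>1 \<cdot> \<beta>1) (\<beta>2 \<cdot> \<beta>2) x y =
      (\<Sum>\<alpha>'\<in>{\<alpha>, \<alpha> \<cdot> \<phi>}. - (1 / g (\<alpha> \<cdot> \<alpha>)) * (\<Sum>s\<in>UNIV. \<alpha>' s * F s))"
    using \<alpha> by (simp only: appellF2_integral cmul_in sum_distrib_left)
  also have "\<dots> = (\<Sum>\<alpha>'\<in>{\<alpha>, \<alpha> \<cdot> \<phi>}. (cinv \<alpha> \<cdot> cinv \<alpha>) (y / 2) *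
      (poch \<psi> (cinv \<beta>2 \<cdot> \<phi>) \<alpha>' / poch \<psi> \<phi> \<alpha>' *
       hyp2F1 \<psi> \<alpha>' (\<alpha>' \<cdot> cinv \<beta>2 \<cdot> \<phi>) (\<beta>1 \<cdot> \<phi>) ((x / y) ^ 2)))"
  proof (intro sum.cong refl)
    fix \<alpha>' assume "\<alpha>' \<in> {\<alpha>, \<alpha> \<cdot> \<phi>}"
    \<comment> \<open>Both summands can be treated alike because \<alpha> and
      \<open>\<alpha> \<cdot> \<phi>\<close> have the same square.\<close>
    then have \<alpha>': "\<alpha>' \<in> chars" "\<alpha>' \<cdot> \<alpha>' = \<alpha> \<cdot> \<alpha>"
      using \<alpha> cmul_cancel(1)[OF quad_char_in cmul_in[OF \<alpha> \<alpha>]] by (auto simp: cmul_ac)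
    let ?H = "hyp2F1 \<psi> \<alpha>' (\<alpha>' \<cdot> cinv \<beta>2 \<cdot> \<phi>) (\<beta>1 \<cdot> \<phi>) ((x / y) ^ 2)"
    have "\<alpha>' \<cdot> cinv (\<beta>2 \<cdot> \<phi>) = \<alpha>' \<cdot> cinv \<beta>2 \<cdot> \<phi>"
      by (simp add: cinv_cmul cmul_assoc)
    then have F: "(\<Sum>s\<in>UNIV. \<alpha>' s * F s) =
        - cinv \<alpha>' B * g \<alpha>' * poch \<psi> (cinv \<beta>2 \<cdot> \<phi>) \<alpha>' * ?H"
      using sum_hyp0F1_product[of \<alpha>' "\<beta>1 \<cdot> \<phi>" "\<beta>2 \<cdot> \<phi>" A B] \<alpha>' \<beta> AB
      by (simp add: F_def cinv_cmul)
    have ne: "g (\<alpha>' \<cdot> \<phi>) \<noteq> 0" "g \<alpha>' \<noteq> 0" "g \<phi> \<noteq> 0" "g (\<alpha> \<cdot> \<alpha>) \<noteq> 0"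
      using \<alpha> \<alpha>' by (simp_all add: gauss_nonzero)
    have nz: "\<alpha>' 4 \<noteq> 0" "\<alpha>' (y / 2) \<noteq> 0"
      using four_nonzero two xy(2) chars_eq_0_iff[OF \<alpha>'(1)] by simp_all
    \<comment> \<open>Since \<open>B * 4\<close> is the square of \<open>y / 2\<close>, passing from
      \<open>B\<close> to \<open>y / 2\<close> costs a factor \<open>\<alpha>' 4\<close>. It cancels
      against the one in Hasse-Davenport for \<open>g (\<alpha> \<cdot> \<alpha>)\<close>.\<close>
    have "w ^ 2 * 4 = (2 * w) * (2 * w)" for w :: 'a
      by (simp add: power2_eq_square)
    from this[of "y / 4"] have "B * 4 = (2 * (y / 4)) * (2 * (y / 4))"
      unfolding B_def .
    moreover have "2 * (y / 4) = y / 2"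
      using two four_nonzero by (simp add: field_simps)
    ultimately have "B * 4 = (y / 2) * (y / 2)" by (simp only:)
    then have "\<alpha>' B * \<alpha>' 4 = \<alpha>' (y / 2) * \<alpha>' (y / 2)"
      by (simp only: chars_mult[OF \<alpha>'(1), symmetric])
    then have "\<alpha>' B = \<alpha>' (y / 2) * \<alpha>' (y / 2) / \<alpha>' 4"
      using nz by (simp add: field_simps)
    then have "cinv \<alpha>' B = \<alpha>' 4 * inverse ((\<alpha>' \<cdot> \<alpha>') (y / 2))"
      by (simp only: cinv_apply cmul_apply inverse_divide) (simp only: divide_inverse)
    then have B: "cinv \<alpha>' B = \<alpha>' 4 * (cinv \<alpha> \<cdot> cinv \<alpha>) (y / 2)"
      unfolding \<alpha>'(2) by (simp add: cmul_apply cinv_apply)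
    have hd: "g (\<alpha> \<cdot> \<alpha>) = g \<alpha>' * g (\<alpha>' \<cdot> \<phi>) * \<alpha>' 4 / g \<phi>"
      using hasse_davenport[OF \<alpha>'(1)] ne by (simp add: \<alpha>'(2) field_simps)
    have "cinv \<alpha>' B * g \<alpha>' / g (\<alpha> \<cdot> \<alpha>) = (cinv \<alpha> \<cdot> cinv \<alpha>) (y / 2) / poch \<psi> \<phi> \<alpha>'"
      unfolding hd B poch_def cmul_commute[of \<phi>] using ne nz by simp
    moreover have "- (1 / g (\<alpha> \<cdot> \<alpha>)) * (\<Sum>s\<in>UNIV. \<alpha>' s * F s) =
        cinv \<alpha>' B * g \<alpha>' / g (\<alpha> \<cdot> \<alpha>) * (poch \<psi> (cinv \<beta>2 \<cdot> \<phi>) \<alpha>' * ?H)"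
      unfolding F by simp
    ultimately show "- (1 / g (\<alpha> \<cdot> \<alpha>)) * (\<Sum>s\<in>UNIV. \<alpha>' s * F s) =
        (cinv \<alpha> \<cdot> cinv \<alpha>) (y / 2) * (poch \<psi> (cinv \<beta>2 \<cdot> \<phi>) \<alpha>' / poch \<psi> \<phi> \<alpha>' * ?H)"
      by simp
  qed
  finally show ?thesis by (simp only: sum_distrib_left)
qed

end

text \<open>Besides the nontrivial additive characters, \<^const>\<open>nontriv_add_char\<close> also admits the zero
  function; then all Gauss sums vanish and both sides are \<open>0\<close>.\<close>
theorem theorem3p12:
  fixes \<psi> \<alpha> \<beta>1 \<beta>2 :: "'a::{field,finite} \<Rightarrow> complex" and l :: 'a
  assumes "CHAR('a) \<noteq> 2"
    and "nontriv_add_char \<psi>"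
    and "\<alpha> \<in> chars" "\<beta>1 \<in> chars" "\<beta>2 \<in> chars"
    and "\<beta>1 \<noteq> \<epsilon>" "\<beta>2 \<noteq> \<epsilon>"
    and "l \<noteq> 1"
  shows "appellF2 \<psi> (\<alpha> \<cdot> \<alpha>) \<beta>1 \<beta>2 (\<beta>1 \<cdot> \<beta>1) (\<beta>2 \<cdot> \<beta>2) (1 + l) (1 - l) =
    (cinv \<alpha> \<cdot> cinv \<alpha>) ((1 - l) / 2) *
    (\<Sum>\<alpha>'\<in>{\<alpha>, \<alpha> \<cdot> \<phi>}.
       poch \<psi> (cinv \<beta>2 \<cdot> \<phi>) \<alpha>' / poch \<psi> \<phi> \<alpha>' *
       hyp2F1 \<psi> \<alpha>' (\<alpha>' \<cdot> cinv \<beta>2 \<cdot> \<phi>) (\<beta>1 \<cdot> \<phi>) (((1 + l) / (1 - l)) ^ 2))"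
proof -
  have add: "\<psi> (x + y) = \<psi> x * \<psi> y" for x y
    using assms(2) by (simp add: nontriv_add_char_def)
  have "\<psi> 0 * (\<psi> 0 - 1) = 0"
    using add[of 0 0] by (simp add: algebra_simps)
  then consider "\<psi> 0 = 0" | "l = - 1" | "\<psi> 0 = 1" "l \<noteq> - 1"
    by force
  then show ?thesis
  proof cases
    case 1
    then have "\<psi> x = 0" for x using add[of x 0] by simp
    then have "poch \<psi> \<eta> \<nu> = 0" for \<eta> \<nu> by (simp add: poch_def gauss_def)
    then show ?thesis by (simp add: appellF2_def)
  next
    \<comment> \<open>Here \<open>1 + l\<close> and the argument of \<open>hyp2F1\<close> are 0,
      where every character, even \<epsilon>, vanishes; both sides are 0.\<close>
    case 2
    then show ?thesis by (simp add: appellF2_def hyp2F1_def chars_zero)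
  next
    case 3
    interpret odd_additive_character \<psi> "of_nat (card (UNIV :: 'a set))"
      using 3 assms(2) char_two_nonzero[OF assms(1)]
      by unfold_locales (simp_all add: nontriv_add_char_def)
    have "1 + l \<noteq> 0" "1 - l \<noteq> 0" "1 + l + (1 - l) = 2"
      using 3 assms(8) by (simp_all add: add_eq_0_iff)
    then show ?thesis
      by (intro appellF2_square_parameters assms)
  qed
qed

end
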